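(* Let $\alpha>1$ be such that $\sigma=\sigma(\alpha)=\dfrac{\pi}{\sqrt{\alpha^2-1}-\arccos\frac1\alpha}$ is rational, and let $q_1,q_2\in\mathbb{N}$ be coprime such that $\sigma=\frac{q_1}{q_2}$. Assume that at least one of the following two conditions holds: (C1) $4$ is not a divisor of $q_1$; (C2) $q_2$ is even. Let $$\Sigma=\{\,j_{\ell,k}^2-\alpha^2\ell^2:\ \ell\in\mathbb{N}_0,\ k\in\mathbb{N}\,\}.$$ Then: (i) $\Sigma$ consists of eigenvalues with finite multiplicity. (ii) There exists $c>0$ such that for each $\ell\in\mathbb{N}_0$, $k\in\mathbb{N}$ we either have $j_{\ell,k}^2-\alpha^2\ell^2=0$ or $|j_{\ell,k}^2-\alpha^2\ell^2|\ge c\,j_{\ell,k}$. (iii) $\Sigma$ has no finite accumulation points.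
   Context: $\mathbb{N}=\{1,2,\dots\}$, $\mathbb{N}_0=\mathbb{N}\cup\{0\}$. For $\ell\in\mathbb{N}_0$, $k\in\mathbb{N}$, $j_{\ell,k}$ is the $k$-th positive zero of the Bessel function of the first kind $J_\ell$. The set $\Sigma$ is the set of Dirichlet eigenvalues of $L_\alpha=-\Delta+\alpha^2\partial_\theta^2$ on the open unit disk $\mathbf{B}\subset\mathbb{R}^2$, where $\partial_\theta=x_1\partial_{x_2}-x_2\partial_{x_1}$; an orthonormal basis of $L^2(\mathbf{B})$ of eigenfunctions is given in polar coordinates by suitably normalized $\cos(\ell\theta)J_\ell(j_{\ell,k}r)$ (for $\ell\ge0$) and $\sin(\ell\theta)J_\ell(j_{\ell,k}r)$ (for $\ell\ge1$), with eigenvalue $j_{\ell,k}^2-\alpha^2\ell^2$. Thus an eigenvalue $\lambda\in\Sigma$ has finite multiplicity if and only if there are only finitely many pairs $(\ell,k)\in\mathbb{N}_0\times\mathbb{N}$ with $j_{\ell,k}^2-\alpha^2\ell^2=\lambda$. *)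

theory Defs
  imports "HOL-Analysis.Analysis"
begin

definition bessel_J :: "nat \<Rightarrow> real \<Rightarrow> real" where
  "bessel_J l x = (\<Sum>m. (- 1) ^ m / (fact m * fact (m + l)) * (x / 2) ^ (2 * m + l))"

text \<open>
  The zero number \<open>k\<close> (counted from 1) is the positive zero \<open>x\<close> with exactly \<open>k\<close> positive
  zeros in \<open>(0, x]\<close>. Positive zeros of Bessel functions are simple, so nothing is lost by
  counting them without multiplicity. The value at \<open>k = 0\<close> is meaningless.
\<close>
definition bessel_zero :: "nat \<Rightarrow> nat \<Rightarrow> real" where
  "bessel_zero l k = (THE x. x > 0 \<and> bessel_J l x = 0 \<and>
     card {y. 0 < y \<and> y \<le> x \<and> bessel_J l y = 0} = k)"

definition sigma_of :: "real \<Rightarrow> real" where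
  "sigma_of \<alpha> = pi / (sqrt (\<alpha>\<^sup>2 - 1) - arccos (1 / \<alpha>))"

definition eigenvalue :: "real \<Rightarrow> nat \<Rightarrow> nat \<Rightarrow> real" where
  "eigenvalue \<alpha> l k = (bessel_zero l k)\<^sup>2 - \<alpha>\<^sup>2 * (real l)\<^sup>2"

definition Spec :: "real \<Rightarrow> real set" where
  "Spec \<alpha> = {eigenvalue \<alpha> l k | l k. k \<ge> 1}"

text \<open>
  The Dirichlet eigenfunctions \<open>cos (l \<theta>) J\<^sub>l (j\<^sub>l\<^sub>,\<^sub>k r)\<close> and, for \<open>l \<ge> 1\<close>,
  \<open>sin (l \<theta>) J\<^sub>l (j\<^sub>l\<^sub>,\<^sub>k r)\<close>, suitably normalized, form an orthonormal basis of \<open>L\<^sup>2\<close> of the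
  unit disk. Each pair \<open>(l, k)\<close> therefore contributes one or two dimensions to the eigenspace of
  \<open>eigenvalue \<alpha> l k\<close>, and an eigenvalue has finite multiplicity iff it is attained at only
  finitely many pairs.
\<close>
definition finite_multiplicity :: "real \<Rightarrow> real \<Rightarrow> bool" where
  "finite_multiplicity \<alpha> \<mu> \<longleftrightarrow> finite {(l, k). k \<ge> 1 \<and> eigenvalue \<alpha> l k = \<mu>}"

end

theory Submission
  imports Defs "HOL-Complex_Analysis.Complex_Analysis" "HOL-Probability.Distributions"
    "HOL-Real_Asymp.Real_Asymp"
begin

text \<open>
  Since \<open>j\<^sup>2 - \<alpha>\<^sup>2 l\<^sup>2 = (j - \<alpha> l) (j + \<alpha> l)\<close>, everything reduces to one fact about the zeros of
  \<open>J\<^sub>l\<close>: for some \<open>\<delta> > 0\<close> and all large \<open>l\<close>, the function \<open>J\<^sub>l\<close> has no zero within distance \<open>\<delta>\<close> of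
  \<open>\<alpha> l\<close> (\<open>no_bessel_zeros_near_ray\<close>). For the pairs with \<open>\<bar>j - \<alpha> l\<bar> \<ge> \<delta>\<close> one has
  \<open>\<bar>j\<^sup>2 - \<alpha>\<^sup>2 l\<^sup>2\<bar> \<ge> \<delta> (j + \<alpha> l)\<close>, which bounds the eigenvalue below by a multiple of \<open>j\<close> and lets only
  finitely many of them produce eigenvalues in a bounded interval; the other pairs have bounded \<open>l\<close>
  and bounded \<open>j\<close>, so there are finitely many of them.

  The absence of zeros follows from Debye's leading-order asymptotics in the oscillatory region:
  for \<open>x \<rightarrow> \<infinity>\<close>, uniformly in \<open>n \<le> x / \<alpha>0\<close> for fixed \<open>\<alpha>0 > 1\<close>, a positive multiple of \<open>J\<^sub>n x\<close> is
  \<open>cos (p n x - \<pi> / 4) + o(1)\<close> with \<open>p n x = sqrt (x\<^sup>2 - n\<^sup>2) - n arccos (n / x)\<close>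
  (\<open>bessel_J_asymptotic\<close>). On the ray \<open>x = \<alpha> n\<close> the phase is \<open>p n (\<alpha> n) = n \<pi> / \<sigma> = n \<pi> q2 / q1\<close>.
  Each of the two arithmetic conditions implies that \<open>4\<close> does not divide \<open>q1\<close> (if \<open>q2\<close> is even, then
  \<open>q1\<close> is odd by coprimality). A zero of \<open>cos (n \<pi> q2 / q1 - \<pi> / 4)\<close> would give
  \<open>4 n q2 = q1 (2 i + 1)\<close> with an integer \<open>i\<close>, hence \<open>4\<close> would divide \<open>q1\<close>; so this cosine never vanishes. Its absolute value is
  periodic in \<open>n\<close>, so it is bounded below. As \<open>p n\<close> is 1-Lipschitz in \<open>x\<close>, the bound persists in a
  window of fixed width around \<open>\<alpha> n\<close>.

  The asymptotics come from Bessel's integral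
  \<open>\<pi> J\<^sub>n x = Re (\<integral>\<^sub>0\<^sup>\<pi> exp (i (n t - x sin t)) dt)\<close> by the method of stationary phase: near the
  stationary point \<open>arccos (n / x)\<close> the phase is replaced by its quadratic Taylor polynomial, which
  gives a Fresnel integral (\<open>fresnel_primitive\<close>), and elsewhere one integration by parts shows that
  the contribution is negligible (\<open>first_derivative_test\<close>). The same asymptotics make \<open>J\<^sub>l\<close> change
  sign infinitely often, so that \<open>bessel_zero l k\<close> really is the zero with number \<open>k\<close>, for all
  \<open>k \<ge> 1\<close> (\<open>bessel_zero_props\<close>).
\<close>

section \<open>Bessel's integral\<close>

lemma integral_cis_period:
  fixes k :: int
  shows "integral {-pi..pi} (\<lambda>t. cis (of_int k * t)) = (if k = 0 then of_real (2 * pi) else 0)"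
proof (cases "k = 0")
  case True
  then show ?thesis by (simp add: scaleR_conv_of_real)
next
  case False
  have d: "((\<lambda>t. - \<i> / of_int k * cis (of_int k * t)) has_vector_derivative cis (of_int k * t)) (at t)" for t
  proof -
    have "((\<lambda>t. of_int k * t) has_derivative (\<lambda>x. of_int k * x)) (at t)"
      by (auto intro!: derivative_eq_intros)
    from has_vector_derivative_mult_right[of "\<lambda>t. cis (of_int k * t)" "of_int k *\<^sub>R (\<i> * cis (of_int k * t))" "at t" "- \<i> / of_int k"]
      has_derivative_cis[OF this]
    show ?thesis using False
      by (simp add: has_vector_derivative_def scaleR_conv_of_real mult_ac)
  qed
  have "((\<lambda>t. cis (of_int k * t)) has_integral
      - \<i> / of_int k * cis (of_int k * pi) - (- \<i> / of_int k * cis (of_int k * - pi))) {-pi..pi}"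
    by (rule fundamental_theorem_of_calculus) (use has_vector_derivative_at_within[OF d] in auto)
  moreover have "cis (of_int k * pi) = cis (of_int k * - pi)"
    by (simp add: complex_eq_iff mult.commute)
  ultimately show ?thesis using False by (simp add: integral_unique)
qed

text \<open>
  With \<open>w = exp (i t)\<close> one has \<open>exp (- i x sin t) = exp (- x w / 2) exp (x / (2 w))\<close>. Expanding both
  exponentials, the powers of \<open>w\<close> that survive the integration against \<open>w\<^sup>n\<close> over a full period are
  exactly the pairs of indices \<open>(a, a + n)\<close>, and these produce the power series of \<open>J\<^sub>n\<close>. The
  expansions converge uniformly on the unit circle, which justifies integrating them term by term;
  convergence of the series for \<open>J\<^sub>n\<close> is obtained along the way. The integral over the negative half
  of the period is the complex conjugate of that over the positive half.
\<close>
lemma bessel_integral: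
  "pi * bessel_J n x = Re (integral {0..pi} (\<lambda>t. cis (real n * t - x * sin t)))"
proof -
  define E where "E N z = (\<Sum>k<N. inverse (fact k) * (z::complex) ^ k)" for N :: nat and z
  define h where "h t = cis (real n * t - x * sin t)" for t
  define trm where "trm m = (-1) ^ m / (fact m * fact (m + n)) * (x / 2) ^ (2 * m + n)" for m
  \<comment> \<open>The second truncation is longer by \<open>n\<close>, so that the pairs \<open>(a, a + n)\<close> with \<open>a < N\<close> all occur.\<close>
  define f where "f N t = cis (real n * t) * (E N (of_real (- x / 2) * cis t) * E (N + n) (of_real (x / 2) * cis (- t)))" for N t
  have expu: "uniform_limit {-pi..pi} (\<lambda>N t. E N (c t)) (\<lambda>t. exp (c t)) sequentially"
    if "\<And>t. norm (c t) \<le> r" for c :: "real \<Rightarrow> complex" and r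
  proof -
    have "uniform_limit (cball 0 r) (\<lambda>N (z::complex). \<Sum>k<N. inverse (fact k) * (z - 0) ^ k)
        (\<lambda>z. \<Sum>k. inverse (fact k) * (z - 0) ^ k) sequentially" 
      
    proof (rule powser_uniform_limit)
      have "conv_radius (\<lambda>k. inverse (fact k) :: complex) = \<infinity>"
        by (rule conv_radius_inftyI'') (rule summable_exp)
      then show "ereal r < conv_radius (\<lambda>k. inverse (fact k) :: complex)" by simp
    qed
    then have "uniform_limit (cball 0 r) E exp sequentially"
      by (simp add: E_def[abs_def] exp_def[abs_def] scaleR_conv_of_real)
    then show ?thesis
      unfolding uniform_limit_iff
    proof (intro allI impI)
      fix e :: real assume "e > 0"
        and u: "\<forall>e>0. \<forall>\<^sub>F N in sequentially. \<forall>z\<in>cball 0 r. dist (E N z) (exp z) < e"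
      then have "\<forall>\<^sub>F N in sequentially. \<forall>z\<in>cball 0 r. dist (E N z) (exp z) < e" by blast
      then show "\<forall>\<^sub>F N in sequentially. \<forall>t\<in>{-pi..pi}. dist (E N (c t)) (exp (c t)) < e"
        by (rule eventually_mono) (use that in auto)
    qed
  qed
  have u1: "uniform_limit {-pi..pi} (\<lambda>N t. E N (of_real (- x / 2) * cis t)) (\<lambda>t. exp (of_real (- x / 2) * cis t)) sequentially"
    by (rule expu[where r = "\<bar>x\<bar> / 2"]) (simp add: norm_mult)
  have u2: "uniform_limit {-pi..pi} (\<lambda>N t. E (N + n) (of_real (x / 2) * cis (- t))) (\<lambda>t. exp (of_real (x / 2) * cis (- t))) sequentially"
  proof -
    have "uniform_limit {-pi..pi} (\<lambda>N t. E N (of_real (x / 2) * cis (- t))) (\<lambda>t. exp (of_real (x / 2) * cis (- t))) sequentially"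
      by (rule expu[where r = "\<bar>x\<bar> / 2"]) (simp add: norm_mult)
    from filterlim_compose[OF this filterlim_add_const_nat_at_top[of n]] show ?thesis .
  qed
  have bnd: "bounded ((\<lambda>t. exp (c t)) ` {-pi..pi})" if "continuous_on {-pi..pi} c" for c :: "real \<Rightarrow> complex"
    by (intro compact_imp_bounded compact_continuous_image continuous_intros that) auto
  have u3: "uniform_limit {-pi..pi} (\<lambda>N t. E N (of_real (- x / 2) * cis t) * E (N + n) (of_real (x / 2) * cis (- t)))
      (\<lambda>t. exp (of_real (- x / 2) * cis t) * exp (of_real (x / 2) * cis (- t))) sequentially"
    by (rule uniform_lim_mult[OF u1 u2]) (auto intro!: bnd continuous_intros)
  have heq: "h t = cis (real n * t) * (exp (of_real (- x / 2) * cis t) * exp (of_real (x / 2) * cis (- t)))" for t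
  proof -
    have "of_real (- x / 2) * cis t + of_real (x / 2) * cis (- t) = \<i> * of_real (- (x * sin t))"
      by (simp add: complex_eq_iff)
    then have "exp (of_real (- x / 2) * cis t) * exp (of_real (x / 2) * cis (- t)) = cis (- (x * sin t))"
      by (simp only: exp_add[symmetric] cis_conv_exp)
    then show ?thesis by (simp add: h_def cis_mult)
  qed
  have u4: "uniform_limit {-pi..pi} f h sequentially"
    unfolding uniform_limit_iff
  proof (intro allI impI)
    fix e :: real assume "e > 0"
    with u3[unfolded uniform_limit_iff] 
    show "\<forall>\<^sub>F N in sequentially. \<forall>t\<in>{-pi..pi}. dist (f N t) (h t) < e"
      by (simp add: f_def heq dist_norm norm_mult flip: right_diff_distrib)
  qed
  have contf: "continuous_on {-pi..pi} (f N)" for N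
    unfolding f_def E_def by (intro continuous_intros)
  obtain I L where I: "\<And>N. (f N has_integral I N) {-pi..pi}" and L: "(h has_integral L) {-pi..pi}"
    and lim: "I \<longlonglongrightarrow> L"
    using uniform_limit_integral[OF u4 contf] by auto
  have IN: "I N = of_real (2 * pi * (\<Sum>a<N. trm a))" for N
  proof -
    define w where "w a b = complex_of_real (inverse (fact a) * (- x / 2) ^ a * (inverse (fact b) * (x / 2) ^ b))" for a b :: nat
    have fe: "f N t = (\<Sum>a<N. \<Sum>b<N + n. w a b * cis (of_int (int n + int a - int b) * t))" for t
    proof -
      have "cis (real n * t) * (inverse (fact a) * (of_real (- x / 2) * cis t) ^ a *
            (inverse (fact b) * (of_real (x / 2) * cis (- t)) ^ b))
          = w a b * cis (of_int (int n + int a - int b) * t)" for a b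
      proof -
        have "cis (of_int (int n + int a - int b) * t) = cis (real n * t) * (cis t ^ a * cis (- t) ^ b)"
          by (simp add: Complex.DeMoivre cis_mult algebra_simps)
        then show ?thesis 
          by (simp only: w_def power_mult_distrib of_real_mult of_real_power of_real_inverse of_real_fact mult_ac)
      qed
      then show ?thesis
        unfolding f_def E_def by (subst sum_product) (simp only: sum_distrib_left)
    qed
    have "I N = integral {-pi..pi} (\<lambda>t. \<Sum>a<N. \<Sum>b<N + n. w a b * cis (of_int (int n + int a - int b) * t))"
      using integral_unique[OF I[of N]] by (simp add: fe[abs_def])
    also have "\<dots> = (\<Sum>a<N. \<Sum>b<N + n. w a b * integral {-pi..pi} (\<lambda>t. cis (of_int (int n + int a - int b) * t)))"
      by (simp add: integral_sum integrable_continuous_real continuous_intros del: of_int_diff of_int_add)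
    also have "\<dots> = (\<Sum>a<N. \<Sum>b<N + n. if b = a + n then w a b * of_real (2 * pi) else 0)"
      by (intro sum.cong refl) (auto simp: integral_cis_period simp del: of_int_diff of_int_add)
    also have "\<dots> = (\<Sum>a<N. w a (a + n) * of_real (2 * pi))"
      by (intro sum.cong refl) (simp add: sum.delta)
    also have "\<dots> = of_real (2 * pi * (\<Sum>a<N. trm a))"
      unfolding sum_distrib_left of_real_sum w_def trm_def
    proof (intro sum.cong refl)
      fix a
      have "(- x / 2) ^ a * (x / 2) ^ (a + n) = (-1) ^ a * (x / 2) ^ (2 * a + n)"
        unfolding minus_divide_left[symmetric] power_minus[of "x / 2"]
        by (simp only: mult.assoc power_add[symmetric] mult_2 add.assoc)
      then have "inverse (fact a) * (- x / 2) ^ a * (inverse (fact (a + n)) * (x / 2) ^ (a + n)) =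
          (- 1) ^ a / (fact a * fact (a + n)) * (x / 2) ^ (2 * a + n)"
        by (simp add: divide_simps mult_ac)
      then show "complex_of_real (inverse (fact a) * (- x / 2) ^ a * (inverse (fact (a + n)) * (x / 2) ^ (a + n))) *
           complex_of_real (2 * pi) =
         complex_of_real (2 * pi * ((- 1) ^ a / (fact a * fact (a + n)) * (x / 2) ^ (2 * a + n)))"
        by (simp only: of_real_mult mult_ac mult_1_right)
    qed
    finally show ?thesis .
  qed
  have "(\<lambda>N. Re (I N)) \<longlonglongrightarrow> Re L" using lim by (rule tendsto_Re)
  then have "(\<lambda>N. (2 * pi * (\<Sum>a<N. trm a)) / (2 * pi)) \<longlonglongrightarrow> Re L / (2 * pi)"
    unfolding IN Re_complex_of_real by (intro tendsto_intros) auto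
  then have "trm sums (Re L / (2 * pi))" by (simp add: sums_def)
  then have J: "bessel_J n x = Re L / (2 * pi)"
    unfolding bessel_J_def trm_def by (rule sums_unique[symmetric])
  have hint: "h integrable_on {c..d}" for c d
    unfolding h_def by (intro integrable_continuous_real continuous_intros)
  have "L = integral {-pi..0} h + integral {0..pi} h"
    using integral_unique[OF L] Henstock_Kurzweil_Integration.integral_combine[OF _ _ hint, of "-pi" 0 pi] by simp
  also have "integral {-pi..0} h = cnj (integral {0..pi} h)"
  proof -
    have "integral {-pi..-0} h = integral {0..pi} (\<lambda>t. h (- t))"
      using Henstock_Kurzweil_Integration.integral_reflect_real[of pi 0 "\<lambda>t. h (- t)"] by simp
    also have "(\<lambda>t. h (- t)) = (\<lambda>t. cnj (h t))"
      by (auto simp: h_def cis_cnj)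
    finally show ?thesis by (simp add: integral_cnj)
  qed
  finally show ?thesis unfolding J h_def by simp
qed

section \<open>Oscillatory integrals\<close>

lemma norm_cis_diff_le: "norm (cis a - cis b) \<le> \<bar>a - b\<bar>"
proof -
  have "(norm (cis a - cis b))\<^sup>2 = (cos a - cos b)\<^sup>2 + (sin a - sin b)\<^sup>2"
    by (simp add: cmod_power2)
  also have "\<dots> = ((sin a)\<^sup>2 + (cos a)\<^sup>2) + ((sin b)\<^sup>2 + (cos b)\<^sup>2) - 2 * (cos a * cos b + sin a * sin b)"
    by (simp add: power2_eq_square algebra_simps)
  also have "\<dots> = 2 - 2 * cos (a - b)"
    by (simp add: cos_diff)
  also have "\<dots> = 2 - 2 * cos (2 * ((a - b) / 2))"
    by (simp only: mult_2 field_sum_of_halves)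
  also have "\<dots> = (2 * sin ((a - b) / 2))\<^sup>2"
    by (subst cos_double_sin) (simp add: power2_eq_square)
  also have "\<dots> \<le> (a - b)\<^sup>2"
    using abs_sin_x_le_abs_x[of "(a - b) / 2"] by (subst abs_le_square_iff[symmetric]) (simp add: abs_mult)
  finally show ?thesis
    by (metis abs_le_square_iff abs_norm_cancel)
qed

text \<open>
  A case of van der Corput's estimate: a phase that moves fast everywhere produces cancellation.
  Integrate by parts with the factor \<open>1 / (i \<psi>')\<close>; as \<open>\<psi>'\<close> is monotone, the remaining integrand is
  dominated by the derivative of \<open>- 1 / \<psi>'\<close>, whose integral telescopes.
\<close>
lemma first_derivative_test:
  fixes \<psi> \<psi>' \<psi>'' :: "real \<Rightarrow> real"
  assumes ab: "a \<le> b" and m: "m > 0"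
    and d1: "\<And>t. t \<in> {a..b} \<Longrightarrow> (\<psi> has_real_derivative \<psi>' t) (at t)"
    and d2: "\<And>t. t \<in> {a..b} \<Longrightarrow> (\<psi>' has_real_derivative \<psi>'' t) (at t)"
    and c2: "continuous_on {a..b} \<psi>''"
    and nonneg: "\<And>t. t \<in> {a..b} \<Longrightarrow> \<psi>'' t \<ge> 0"
    and big: "\<And>t. t \<in> {a..b} \<Longrightarrow> \<bar>\<psi>' t\<bar> \<ge> m"
  shows "norm (integral {a..b} (\<lambda>t. cis (\<psi> t))) \<le> 4 / m"
proof -
  define G where "G t = cis (\<psi> t) * (- \<i> * of_real (inverse (\<psi>' t)))" for t
  define r where "r t = \<psi>'' t / (\<psi>' t)\<^sup>2" for t
  have nz: "\<psi>' t \<noteq> 0" if "t \<in> {a..b}" for t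
    using big[OF that] m by auto
  have c0: "continuous_on {a..b} \<psi>" and c1: "continuous_on {a..b} \<psi>'"
    using d1 d2 by (meson DERIV_isCont continuous_at_imp_continuous_on)+
  have contcis: "continuous_on {a..b} (\<lambda>t. cis (\<psi> t))"
    by (intro continuous_intros c0)
  have contr: "continuous_on {a..b} r"
    unfolding r_def by (intro continuous_intros c1 c2) (use nz in auto)
  have dinv: "((\<lambda>t. inverse (\<psi>' t)) has_real_derivative - r t) (at t)" if "t \<in> {a..b}" for t
    using DERIV_inverse'[OF d2[OF that] nz[OF that]] nz[OF that]
    by (simp add: r_def power2_eq_square divide_simps)
  have dG: "(G has_vector_derivative (cis (\<psi> t) + cis (\<psi> t) * (\<i> * of_real (r t)))) (at t)" if t: "t \<in> {a..b}" for t
  proof -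
    have 1: "((\<lambda>t. cis (\<psi> t)) has_vector_derivative (\<psi>' t *\<^sub>R (\<i> * cis (\<psi> t)))) (at t)"
      using has_derivative_cis[OF d1[OF t, unfolded has_field_derivative_def]]
      by (simp add: has_vector_derivative_def mult_ac scaleR_conv_of_real)
    have 2: "((\<lambda>t. of_real (inverse (\<psi>' t)) :: complex) has_vector_derivative of_real (- r t)) (at t)"
      by (intro has_vector_derivative_of_real dinv[OF t])
    have 3: "(G has_vector_derivative (cis (\<psi> t) * (- \<i> * of_real (- r t)) +
         (\<psi>' t *\<^sub>R (\<i> * cis (\<psi> t))) * (- \<i> * of_real (inverse (\<psi>' t))))) (at t)"
      unfolding G_def
      by (rule has_vector_derivative_mult[OF 1 has_vector_derivative_mult_right[OF 2]])
    show ?thesis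
      using 3 nz[OF t] by (simp add: scaleR_conv_of_real algebra_simps)
  qed
  have IG: "((\<lambda>t. cis (\<psi> t) + cis (\<psi> t) * (\<i> * of_real (r t))) has_integral G b - G a) {a..b}"
    by (rule fundamental_theorem_of_calculus[OF ab]) (use dG has_vector_derivative_at_within in blast)
  have Ir: "(r has_integral inverse (\<psi>' a) - inverse (\<psi>' b)) {a..b}"
  proof -
    have "(r has_integral - inverse (\<psi>' b) - (- inverse (\<psi>' a))) {a..b}"
    proof (rule fundamental_theorem_of_calculus[OF ab])
      fix t assume "t \<in> {a..b}"
      from DERIV_minus[OF dinv[OF this]]
      show "((\<lambda>t. - inverse (\<psi>' t)) has_vector_derivative r t) (at t within {a..b})"
        by (simp add: has_real_derivative_iff_has_vector_derivative has_vector_derivative_at_within)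
    qed
    then show ?thesis by simp
  qed
  have int2: "(\<lambda>t. cis (\<psi> t) * (\<i> * of_real (r t))) integrable_on {a..b}"
    by (intro integrable_continuous_real continuous_intros contcis contr)
  have eq: "integral {a..b} (\<lambda>t. cis (\<psi> t)) = (G b - G a) - integral {a..b} (\<lambda>t. cis (\<psi> t) * (\<i> * of_real (r t)))"
    using integral_unique[OF IG] integral_add[OF integrable_continuous_real[OF contcis] int2] by (simp add: algebra_simps)
  have bound: "norm (integral {a..b} (\<lambda>t. cis (\<psi> t) * (\<i> * of_real (r t)))) \<le> integral {a..b} r"
    by (rule integral_norm_bound_integral[OF int2])
       (use Ir nonneg in \<open>auto simp: norm_mult r_def norm_divide norm_power\<close>)
  have inv: "\<bar>inverse (\<psi>' t)\<bar> \<le> 1 / m" if "t \<in> {a..b}" for t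
    using big[OF that] m by (simp add: divide_simps)
  have "norm (G t) \<le> 1 / m" if "t \<in> {a..b}" for t
    using inv[OF that] by (simp add: G_def norm_mult norm_inverse)
  then have "norm (G a) \<le> 1 / m" "norm (G b) \<le> 1 / m" using ab by auto
  moreover have "integral {a..b} r \<le> 1 / m + 1 / m"
    using integral_unique[OF Ir] abs_le_D1[OF inv[of a]] abs_le_D2[OF inv[of b]] ab by simp
  ultimately show ?thesis
    using bound norm_triangle_ineq4[of "G b - G a" "integral {a..b} (\<lambda>t. cis (\<psi> t) * (\<i> * of_real (r t)))"]
      norm_triangle_ineq4[of "G b" "G a"] unfolding eq by (simp add: field_simps)
qed

lemma gaussian_integral_limit:
  "((\<lambda>R. integral {0..R} (\<lambda>s::real. exp (- s\<^sup>2))) \<longlongrightarrow> sqrt pi / 2) at_top"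
proof -
  let ?f = "\<lambda>x::real. indicator {0..} x *\<^sub>R exp (- x\<^sup>2) :: real"
  have int: "integrable lborel ?f" and val: "integral\<^sup>L lborel ?f = sqrt pi / 2"
    using gaussian_moment_0 by (auto simp: has_bochner_integral_iff)
  have "((\<lambda>y. \<integral>x. indicator {..y} x *\<^sub>R ?f x \<partial>lborel) \<longlongrightarrow> sqrt pi / 2) at_top"
    using tendsto_integral_at_top[OF _ int] unfolding val by simp
  moreover have "(\<integral>x. indicator {..y} x *\<^sub>R ?f x \<partial>lborel) = integral {0..y} (\<lambda>s. exp (- s\<^sup>2))" for y
  proof -
    have "(\<integral>x. indicator {..y} x *\<^sub>R ?f x \<partial>lborel) = (LINT x:{0..y}|lborel. exp (- x\<^sup>2))"
      unfolding set_lebesgue_integral_def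
      by (intro Bochner_Integration.integral_cong) (auto simp: indicator_def)
    also have "\<dots> = integral {0..y} (\<lambda>s. exp (- s\<^sup>2))"
      by (intro set_borel_integral_eq_integral borel_integrable_atLeastAtMost') (auto intro!: continuous_intros)
    finally show ?thesis .
  qed
  ultimately show ?thesis by simp
qed

text \<open>
  The limit at infinity of an odd primitive of \<open>exp (i r\<^sup>2)\<close>, that is, the Fresnel integral. An
  entire primitive of \<open>exp (i z\<^sup>2)\<close> permits moving from the real axis to the diagonal through
  \<open>1 + i\<close>, where the integrand is a Gaussian; the vertical segment from \<open>R\<close> to \<open>R + i R\<close> contributes
  \<open>O(1 / R)\<close>. Working with the primitive instead of the integral spares changes of variables in
  applications.
\<close>
lemma fresnel_primitive:
  obtains F :: "real \<Rightarrow> complex"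
  where "\<And>r. (F has_vector_derivative cis (r\<^sup>2)) (at r)"
    and "\<And>r. F (- r) = - F r"
    and "(F \<longlongrightarrow> of_real (sqrt pi / 2) * cis (pi / 4)) at_top"
proof -
  obtain g where g: "\<And>z. (g has_field_derivative exp (\<i> * z\<^sup>2)) (at z)"
  proof (rule holomorphic_convex_primitive'[of UNIV "\<lambda>z. exp (\<i> * z\<^sup>2)"])
    show "(\<lambda>z. exp (\<i> * z\<^sup>2)) holomorphic_on UNIV"
      by (intro holomorphic_intros)
  qed auto
  define F where "F r = g (of_real r) - g 0" for r
  have dline: "((\<lambda>t. g (p + of_real t * w)) has_vector_derivative (w * exp (\<i> * (p + of_real t * w)\<^sup>2))) (at t within S)" for p w t S
  proof -
    have 1: "((\<lambda>t. p + of_real t * w) has_vector_derivative w) (at t within S)"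
      by (auto intro!: derivative_eq_intros)
    show ?thesis
      using field_vector_diff_chain_within[OF 1 has_field_derivative_at_within[OF g]] by (simp add: o_def)
  qed
  have dF: "(F has_vector_derivative cis (r\<^sup>2)) (at r)" for r
  proof -
    have "((\<lambda>t. g (0 + of_real t * 1) - g 0) has_vector_derivative (1 * exp (\<i> * (0 + of_real r * 1)\<^sup>2) - 0)) (at r)"
      by (intro has_vector_derivative_diff dline has_vector_derivative_const)
    then show ?thesis by (simp add: F_def[abs_def] cis_conv_exp)
  qed
  have odd: "F (- r) = - F r" for r
  proof -
    have "((\<lambda>t. F t + F (- t)) has_vector_derivative 0) (at t within UNIV)" for t
    proof -
      have "((\<lambda>t. F (- t)) has_vector_derivative (-1) *\<^sub>R cis ((- t)\<^sup>2)) (at t)"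
      proof -
        have "(uminus has_vector_derivative (-1)) (at t)"
          by (auto intro!: derivative_eq_intros)
        from vector_diff_chain_at[OF this dF] show ?thesis by (simp add: o_def)
      qed
      from has_vector_derivative_add[OF dF this] show ?thesis by simp
    qed
    then have "F r + F (- r) = F 0 + F (- 0)"
      by (intro has_derivative_zero_unique[of UNIV "\<lambda>t. F t + F (- t)"])
         (auto simp: has_vector_derivative_def)
    also have "\<dots> = 0" by (simp add: F_def)
    finally show ?thesis by (simp add: add_eq_0_iff)
  qed
  define Gs where "Gs R = integral {0..R} (\<lambda>s::real. exp (- s\<^sup>2))" for R
  have diag: "g (of_real (R / sqrt 2) * (1 + \<i>)) - g 0 = (1 + \<i>) * of_real (Gs R / sqrt 2)" if R: "R \<ge> 0" for R
  proof -
    define w where "w = (1 + \<i>) / of_real (sqrt 2)"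
    have w2: "w\<^sup>2 = \<i>"
      by (simp add: w_def power_divide power2_eq_square algebra_simps flip: of_real_mult)
    have e: "exp (\<i> * (0 + of_real t * w)\<^sup>2) = of_real (exp (- t\<^sup>2))" for t
    proof -
      have "\<i> * (0 + of_real t * w)\<^sup>2 = of_real (- t\<^sup>2)"
        by (simp add: power_mult_distrib w2 mult.left_commute[of \<i>])
      then show ?thesis by (simp only: exp_of_real)
    qed
    have "((\<lambda>t. w * exp (\<i> * (0 + of_real t * w)\<^sup>2)) has_integral g (0 + of_real R * w) - g (0 + of_real 0 * w)) {0..R}"
      by (rule fundamental_theorem_of_calculus[OF R]) (rule dline)
    then have 1: "((\<lambda>t. w * of_real (exp (- t\<^sup>2))) has_integral g (of_real R * w) - g 0) {0..R}"
      unfolding e by simp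
    have "((\<lambda>s::real. exp (- s\<^sup>2)) has_integral Gs R) {0..R}"
      unfolding Gs_def by (intro integrable_integral integrable_continuous_real continuous_intros)
    then have 2: "((\<lambda>t. w * of_real (exp (- t\<^sup>2))) has_integral w * of_real (Gs R)) {0..R}"
      by (intro has_integral_mult_right has_integral_of_real)
    show ?thesis
      using has_integral_unique[OF 1 2] by (simp add: w_def)
  qed
  have side: "norm (g (of_real R * (1 + \<i>)) - g (of_real R)) \<le> 1 / (2 * R)" if R: "R > 0" for R
  proof -
    have e: "norm (\<i> * exp (\<i> * (of_real R + of_real t * \<i>)\<^sup>2)) = exp (- (2 * R * t))" for t
      by (simp add: norm_mult power2_eq_square algebra_simps)
    have 1: "((\<lambda>t. \<i> * exp (\<i> * (of_real R + of_real t * \<i>)\<^sup>2)) has_integral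
        g (of_real R + of_real R * \<i>) - g (of_real R + of_real 0 * \<i>)) {0..R}"
      by (rule fundamental_theorem_of_calculus) (use R dline in auto)
    have "((\<lambda>t. exp (- (2 * R * t))) has_integral
        (- exp (- (2 * R * R)) / (2 * R) - (- exp (- (2 * R * 0)) / (2 * R)))) {0..R}"
      by (rule fundamental_theorem_of_calculus)
         (use R in \<open>auto simp flip: has_real_derivative_iff_has_vector_derivative intro!: derivative_eq_intros\<close>)
    then have 2: "((\<lambda>t. exp (- (2 * R * t))) has_integral (1 - exp (- (2 * R * R))) / (2 * R)) {0..R}"
      by (simp add: diff_divide_distrib)
    have "norm (integral {0..R} (\<lambda>t. \<i> * exp (\<i> * (of_real R + of_real t * \<i>)\<^sup>2)))
        \<le> integral {0..R} (\<lambda>t. exp (- (2 * R * t)))"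
      by (rule integral_norm_bound_integral) (use 1 2 e in auto)
    then have "norm (g (of_real R + of_real R * \<i>) - g (of_real R)) \<le> (1 - exp (- (2 * R * R))) / (2 * R)"
      using integral_unique[OF 1] integral_unique[OF 2] by simp
    also have "\<dots> \<le> 1 / (2 * R)"
      using R by (intro divide_right_mono) auto
    finally show ?thesis by (simp add: algebra_simps)
  qed
  have lim1: "((\<lambda>R. (1 + \<i>) * of_real (Gs (R * sqrt 2) / sqrt 2)) \<longlongrightarrow> (1 + \<i>) * of_real ((sqrt pi / 2) / sqrt 2)) at_top"
  proof -
    have "filterlim (\<lambda>R::real. R * sqrt 2) at_top at_top" by real_asymp
    from filterlim_compose[OF gaussian_integral_limit this]
    have "((\<lambda>R. Gs (R * sqrt 2)) \<longlongrightarrow> sqrt pi / 2) at_top" by (simp add: Gs_def)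
    then show ?thesis by (intro tendsto_intros) auto
  qed
  have lim2: "((\<lambda>R. F R - (1 + \<i>) * of_real (Gs (R * sqrt 2) / sqrt 2)) \<longlongrightarrow> 0) at_top"
  proof (rule Lim_null_comparison)
    show "\<forall>\<^sub>F R in at_top. norm (F R - (1 + \<i>) * of_real (Gs (R * sqrt 2) / sqrt 2)) \<le> 1 / (2 * R)"
      using eventually_gt_at_top[of 0]
    proof eventually_elim
      case (elim R)
      have "F R - (1 + \<i>) * of_real (Gs (R * sqrt 2) / sqrt 2) = g (of_real R) - g (of_real R * (1 + \<i>))"
        using diag[of "R * sqrt 2"] elim by (simp add: F_def algebra_simps)
      then show ?case using side[OF elim] by (simp add: norm_minus_commute)
    qed
    show "((\<lambda>R::real. 1 / (2 * R)) \<longlongrightarrow> 0) at_top" by real_asymp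
  qed
  have "(F \<longlongrightarrow> (1 + \<i>) * of_real ((sqrt pi / 2) / sqrt 2)) at_top"
    using tendsto_add[OF lim2 lim1] by simp
  also have "(1 + \<i>) * of_real ((sqrt pi / 2) / sqrt 2) = of_real (sqrt pi / 2) * cis (pi / 4)"
    by (simp add: complex_eq_iff cos_45 sin_45 field_simps)
  finally show ?thesis using that dF odd by blast
qed

section \<open>Stationary phase for Bessel's integral\<close>

text \<open>
  The negative of the phase \<open>\<nu> t - x sin t\<close> at its stationary point \<open>t = arccos (\<nu> / x)\<close>. The sign is
  that of the phase in Debye's expansion of the Bessel function.
\<close>
definition debye_phase :: "real \<Rightarrow> real \<Rightarrow> real" where
  "debye_phase \<nu> x = sqrt (x\<^sup>2 - \<nu>\<^sup>2) - \<nu> * arccos (\<nu> / x)"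

lemma sin_ge_sin_endpoint:
  assumes "0 \<le> c" "c \<le> u" "u \<le> pi - c"
  shows "sin c \<le> sin u"
proof (cases "u \<le> pi / 2")
  case True
  then show ?thesis using assms by (intro sin_monotone_2pi_le) auto
next
  case False
  have "sin c \<le> sin (pi - u)"
    using assms False by (intro sin_monotone_2pi_le) auto
  then show ?thesis by simp
qed

text \<open>
  This bounds the derivative \<open>x (cos \<beta> - cos t)\<close> of the phase from below outside a window of radius
  \<open>h\<close> around the stationary point \<open>\<beta>\<close>; the constant depends only on a lower bound \<open>\<beta>0\<close> for the
  stationary point.
\<close>
lemma cos_diff_ge:
  fixes \<beta>0 :: real
  assumes "0 < h" "h \<le> 1" "\<beta>0 / 2 \<le> u - h / 2" "u - h / 2 \<le> pi - \<beta>0 / 2" "0 \<le> \<beta>0"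
  shows "cos (u - h) - cos u \<ge> sin (\<beta>0 / 2) * h / 2"
proof -
  have "cos (u - h) - cos u = 2 * sin (u - h / 2) * sin (h / 2)"
    using cos_diff_cos[of "u - h" u] by (simp add: field_simps)
  moreover have "sin (u - h / 2) \<ge> sin (\<beta>0 / 2)"
    using assms by (intro sin_ge_sin_endpoint) auto
  moreover have "sin (h / 2) \<ge> h / 4"
  proof -
    have "\<bar>sin (h / 2) - h / 2\<bar> \<le> (h / 2) ^ 3 / 6"
      using Maclaurin_sin_bound[of "h / 2" 3] assms
      by (simp add: lessThan_Suc numeral_3_eq_3 sin_coeff_def fact_numeral)
    then have "h / 2 - (h / 2) ^ 3 / 6 \<le> sin (h / 2)" by linarith
    moreover have "(h / 2) ^ 3 \<le> h / 2"
      using assms power_decreasing[of 1 3 "h/2"] by simp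
    ultimately show ?thesis using assms(1) by linarith
  qed
  moreover have "sin (\<beta>0 / 2) \<ge> 0"
    using assms by (intro sin_ge_zero) auto
  ultimately have "sin (u - h / 2) * sin (h / 2) \<ge> sin (\<beta>0 / 2) * (h / 4)"
    using assms by (intro mult_mono) auto
  with \<open>cos (u - h) - cos u = _\<close> show ?thesis by simp
qed

text \<open>
  Because \<open>x cos \<beta> = \<nu>\<close>, the terms that are linear in \<open>s\<close> cancel, and the phase changes by
  \<open>\<nu> (s - sin s) + x sin \<beta> (1 - cos s)\<close>.
\<close>
lemma quadratic_phase_error:
  fixes \<nu> x \<beta> s :: real
  assumes "\<nu> = x * cos \<beta>" "x > 0" "\<bar>s\<bar> \<le> h"
  shows "\<bar>(\<nu> * (\<beta> + s) - x * sin (\<beta> + s)) - (\<nu> * \<beta> - x * sin \<beta> + x * sin \<beta> / 2 * s\<^sup>2)\<bar> \<le> x * h ^ 3"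
proof -
  have "(\<nu> * (\<beta> + s) - x * sin (\<beta> + s)) - (\<nu> * \<beta> - x * sin \<beta> + x * sin \<beta> / 2 * s\<^sup>2)
      = x * (cos \<beta> * (s - sin s) + sin \<beta> * (1 - cos s - s\<^sup>2 / 2))"
    using assms(1) by (simp add: sin_add algebra_simps)
  also have "\<bar>\<dots>\<bar> \<le> x * h ^ 3"
  proof -
    have s: "\<bar>s - sin s\<bar> \<le> \<bar>s\<bar> ^ 3 / 2"
    proof -
      have "\<bar>sin s - s\<bar> \<le> \<bar>s\<bar> ^ 3 / 6"
        using Maclaurin_sin_bound[of s 3]
        by (simp add: lessThan_Suc numeral_3_eq_3 sin_coeff_def fact_numeral)
      moreover have "\<bar>s\<bar> ^ 3 \<ge> 0" by simp
      ultimately show ?thesis by linarith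
    qed
    have c: "\<bar>1 - cos s - s\<^sup>2 / 2\<bar> \<le> \<bar>s\<bar> ^ 3 / 2"
    proof -
      obtain t where t: "cos s = (\<Sum>m<3. cos_coeff m * s ^ m) + (cos (t + 1/2 * real 3 * pi) / fact 3) * s ^ 3"
        using Maclaurin_cos_expansion[of s 3] by auto
      have "(\<Sum>m<3. cos_coeff m * s ^ m) = 1 - s\<^sup>2 / 2"
        by (simp add: lessThan_Suc numeral_3_eq_3 cos_coeff_def fact_numeral power2_eq_square)
      with t have "1 - cos s - s\<^sup>2 / 2 = - (cos (t + 1/2 * real 3 * pi) / fact 3) * s ^ 3"
        by simp
      then have "\<bar>1 - cos s - s\<^sup>2 / 2\<bar> = \<bar>cos (t + 1/2 * real 3 * pi)\<bar> / 6 * \<bar>s\<bar> ^ 3"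
        by (simp add: abs_mult power_abs fact_numeral)
      also have "\<dots> \<le> 1 / 6 * \<bar>s\<bar> ^ 3" by (intro mult_right_mono divide_right_mono) auto
      also have "\<dots> \<le> \<bar>s\<bar> ^ 3 / 2" by simp
      finally show ?thesis .
    qed
    have "\<bar>cos \<beta> * (s - sin s) + sin \<beta> * (1 - cos s - s\<^sup>2 / 2)\<bar> \<le> \<bar>cos \<beta>\<bar> * \<bar>s - sin s\<bar> + \<bar>sin \<beta>\<bar> * \<bar>1 - cos s - s\<^sup>2 / 2\<bar>"
      by (metis abs_mult abs_triangle_ineq)
    also have "\<dots> \<le> 1 * (\<bar>s\<bar> ^ 3 / 2) + 1 * (\<bar>s\<bar> ^ 3 / 2)"
      by (intro add_mono mult_mono s c) auto
    also have "\<dots> \<le> h ^ 3" using assms power_mono[of "\<bar>s\<bar>" h 3] by simp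
    finally show ?thesis using assms by (simp add: abs_mult)
  qed
  finally show ?thesis .
qed

text \<open>
  The quantitative form of the method, with a free radius \<open>h\<close> of the window around the stationary
  point. The first error term bounds both tails by the first derivative test, the second one is the
  length of the window times the error of the quadratic approximation. The quadratic phase inside
  the window integrates to values of the Fresnel primitive \<open>F\<close>.
\<close>
lemma stationary_phase_bound:
  fixes \<nu> x \<beta> \<beta>0 h :: real
  assumes \<nu>: "\<nu> = x * cos \<beta>" and x: "x > 0" and b0: "0 < \<beta>0" and b: "\<beta>0 \<le> \<beta>" "\<beta> \<le> pi / 2"
    and h: "0 < h" "h \<le> 1" "h \<le> \<beta>0"
    and F: "\<And>r. (F has_vector_derivative cis (r\<^sup>2)) (at r)" "\<And>r. F (- r) = - F r"
  defines "A \<equiv> x * sin \<beta> / 2"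
  shows "norm (sqrt A * integral {0..pi} (\<lambda>t. cis (\<nu> * t - x * sin t))
      - cis (\<nu> * \<beta> - x * sin \<beta>) * (2 * F (h * sqrt A)))
    \<le> sqrt A * (16 / (x * sin (\<beta>0 / 2) * h) + 2 * x * h ^ 4)"
proof -
  define \<psi> where "\<psi> t = \<nu> * t - x * sin t" for t
  define m where "m = x * (sin (\<beta>0 / 2) * h / 2)"
  define f where "f t = cis (\<psi> t)" for t
  define g where "g t = cis (\<psi> \<beta> + A * (t - \<beta>)\<^sup>2)" for t
  have s0: "sin (\<beta>0 / 2) > 0" using b0 b by (intro sin_gt_zero) auto
  have A: "A > 0" unfolding A_def using x sin_gt_zero[of \<beta>] b b0 pi_gt_zero by simp
  have m: "m > 0" using s0 h x by (simp add: m_def)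
  have hpi: "\<beta> + h \<le> pi" "\<beta> - h \<ge> 0" using b h pi_ge_two by linarith+
  have d1: "(\<psi> has_real_derivative \<nu> - x * cos t) (at t)" for t
    unfolding \<psi>_def by (auto intro!: derivative_eq_intros)
  have d2: "((\<lambda>t. \<nu> - x * cos t) has_real_derivative x * sin t) (at t)" for t
    by (auto intro!: derivative_eq_intros)
  have contf: "continuous_on S f" for S
    unfolding f_def \<psi>_def by (intro continuous_intros)
  have fint: "f integrable_on {c..d}" for c d by (rule integrable_continuous_real[OF contf])
  have contg: "continuous_on S g" for S
    unfolding g_def by (intro continuous_intros)
  have gint: "g integrable_on {c..d}" for c d by (rule integrable_continuous_real[OF contg])
  have left: "norm (integral {0..\<beta> - h} f) \<le> 4 / m"
    unfolding f_def
  proof (rule first_derivative_test[OF hpi(2) m d1 d2])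
    fix t assume t: "t \<in> {0..\<beta> - h}"
    have "cos t \<ge> cos (\<beta> - h)" using t hpi b h pi_gt_zero by (intro cos_monotone_0_pi_le) (simp, simp, linarith)
    moreover have "cos (\<beta> - h) - cos \<beta> \<ge> sin (\<beta>0 / 2) * h / 2"
      using b h b0 by (intro cos_diff_ge) auto
    ultimately have "x * (cos t - cos \<beta>) \<ge> m"
      unfolding m_def using x by (intro mult_left_mono) auto
    then show "m \<le> \<bar>\<nu> - x * cos t\<bar>" by (simp add: \<nu> algebra_simps)
    show "0 \<le> x * sin t" using t x hpi b pi_ge_two h by (intro mult_nonneg_nonneg sin_ge_zero) auto
  qed (intro continuous_intros)
  have right: "norm (integral {\<beta> + h..pi} f) \<le> 4 / m"
    unfolding f_def
  proof (rule first_derivative_test[OF hpi(1) m d1 d2])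
    fix t assume t: "t \<in> {\<beta> + h..pi}"
    have "cos t \<le> cos (\<beta> + h)" using t hpi b b0 h by (intro cos_monotone_0_pi_le) auto
    moreover have "cos (\<beta> + h - h) - cos (\<beta> + h) \<ge> sin (\<beta>0 / 2) * h / 2"
      using b h b0 by (intro cos_diff_ge) auto
    ultimately have "x * (cos \<beta> - cos t) \<ge> m"
      unfolding m_def using x by (intro mult_left_mono) auto
    then show "m \<le> \<bar>\<nu> - x * cos t\<bar>" by (simp add: \<nu> algebra_simps)
    show "0 \<le> x * sin t" using t x hpi b b0 h by (intro mult_nonneg_nonneg sin_ge_zero) auto
  qed (intro continuous_intros)
  have mid: "norm (integral {\<beta> - h..\<beta> + h} f - integral {\<beta> - h..\<beta> + h} g) \<le> 2 * x * h ^ 4"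
  proof -
    have "norm (integral {\<beta> - h..\<beta> + h} (\<lambda>t. f t - g t)) \<le> (x * h ^ 3) * ((\<beta> + h) - (\<beta> - h))"
    proof (rule integral_bound)
      fix t assume "t \<in> {\<beta> - h..\<beta> + h}"
      then have "\<bar>t - \<beta>\<bar> \<le> h" by auto
      from quadratic_phase_error[OF \<nu> x this]
      have "\<bar>\<psi> t - (\<psi> \<beta> + A * (t - \<beta>)\<^sup>2)\<bar> \<le> x * h ^ 3"
        by (simp add: \<psi>_def A_def)
      then show "norm (f t - g t) \<le> x * h ^ 3"
        unfolding f_def g_def using norm_cis_diff_le order_trans by blast
    qed (use h in \<open>auto intro!: continuous_intros contf contg\<close>)
    then show ?thesis
      by (simp add: integral_diff[OF fint gint] power_numeral_reduce algebra_simps)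
  qed
  have split: "integral {0..pi} f = integral {0..\<beta> - h} f + integral {\<beta> - h..\<beta> + h} f + integral {\<beta> + h..pi} f"
    using Henstock_Kurzweil_Integration.integral_combine[OF _ _ fint, of 0 "\<beta> + h" pi]
      Henstock_Kurzweil_Integration.integral_combine[OF _ _ fint, of 0 "\<beta> - h" "\<beta> + h"] hpi h
    by simp
  have main: "sqrt A * integral {\<beta> - h..\<beta> + h} g = cis (\<psi> \<beta>) * (2 * F (h * sqrt A))"
  proof -
    have "((\<lambda>t. cis (\<psi> \<beta>) * F (sqrt A * (t - \<beta>))) has_vector_derivative
        cis (\<psi> \<beta>) * (sqrt A *\<^sub>R cis ((sqrt A * (t - \<beta>))\<^sup>2))) (at t)" for t
    proof -
      have "((\<lambda>t. sqrt A * (t - \<beta>)) has_vector_derivative sqrt A) (at t)"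
        by (auto intro!: derivative_eq_intros simp flip: has_real_derivative_iff_has_vector_derivative)
      from vector_diff_chain_at[OF this F(1)]
      show ?thesis by (intro has_vector_derivative_mult_right) (simp add: o_def)
    qed
    moreover have "cis (\<psi> \<beta>) * (sqrt A *\<^sub>R cis ((sqrt A * (t - \<beta>))\<^sup>2)) = sqrt A * g t" for t
      using A by (simp add: g_def cis_mult[symmetric] scaleR_conv_of_real power_mult_distrib mult_ac)
    ultimately have "((\<lambda>t. cis (\<psi> \<beta>) * F (sqrt A * (t - \<beta>))) has_vector_derivative sqrt A * g t) (at t)" for t
      by simp
    then have "((\<lambda>t. sqrt A * g t) has_integral cis (\<psi> \<beta>) * F (sqrt A * ((\<beta> + h) - \<beta>)) - cis (\<psi> \<beta>) * F (sqrt A * ((\<beta> - h) - \<beta>))) {\<beta> - h..\<beta> + h}"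
      using h by (intro fundamental_theorem_of_calculus) (auto intro: has_vector_derivative_at_within)
    from integral_unique[OF this] show ?thesis
      using F(2)[of "h * sqrt A"] by (simp add: algebra_simps)
  qed
  have "norm (integral {0..pi} f - integral {\<beta> - h..\<beta> + h} g) \<le> 4 / m + 2 * x * h ^ 4 + 4 / m"
    unfolding split using left mid right
      norm_triangle_ineq[of "integral {0..\<beta> - h} f" "integral {\<beta> - h..\<beta> + h} f - integral {\<beta> - h..\<beta> + h} g"]
      norm_triangle_ineq[of "integral {0..\<beta> - h} f + (integral {\<beta> - h..\<beta> + h} f - integral {\<beta> - h..\<beta> + h} g)" "integral {\<beta> + h..pi} f"]
    by (simp add: algebra_simps)
  also have "\<dots> = 16 / (x * sin (\<beta>0 / 2) * h) + 2 * x * h ^ 4"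
    using x s0 h by (simp add: m_def field_simps)
  finally have *: "norm (integral {0..pi} f - integral {\<beta> - h..\<beta> + h} g) \<le> 16 / (x * sin (\<beta>0 / 2) * h) + 2 * x * h ^ 4" .
  have "norm (sqrt A * integral {0..pi} f - cis (\<psi> \<beta>) * (2 * F (h * sqrt A)))
      = norm (of_real (sqrt A) * (integral {0..pi} f - integral {\<beta> - h..\<beta> + h} g))"
    unfolding main[symmetric] by (simp add: algebra_simps)
  also have "\<dots> \<le> sqrt A * (16 / (x * sin (\<beta>0 / 2) * h) + 2 * x * h ^ 4)"
    unfolding norm_mult using A * by (simp add: mult_left_mono)
  finally show ?thesis by (simp add: f_def[abs_def] \<psi>_def)
qed

text \<open>
  Before multiplication by \<open>sqrt A\<close>, which is \<open>O(sqrt x)\<close>, the two error terms are of order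
  \<open>1 / (x h)\<close> and \<open>x h\<^sup>4\<close>. They balance at \<open>h = x powr (- 2 / 5)\<close>, and the product with \<open>sqrt x\<close> is
  then \<open>O(x powr (- 1 / 10))\<close>. At the same time \<open>h sqrt A \<rightarrow> \<infinity>\<close>, so the Fresnel primitive is close to
  its limit. The hypothesis \<open>\<alpha>0 \<nu> \<le> x\<close> keeps the stationary point away from \<open>0\<close>, where it would
  degenerate; this makes the estimate uniform in \<open>\<nu>\<close>.
\<close>
lemma stationary_phase:
  assumes a0: "\<alpha>0 > 1" and e: "\<epsilon> > 0"
  obtains X where "X > 0" and "\<And>\<nu> x. x \<ge> X \<Longrightarrow> 0 \<le> \<nu> \<Longrightarrow> \<alpha>0 * \<nu> \<le> x \<Longrightarrow>
    norm (sqrt (sqrt (x\<^sup>2 - \<nu>\<^sup>2) / 2) * integral {0..pi} (\<lambda>t. cis (\<nu> * t - x * sin t))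
      - sqrt pi * cis (pi / 4 - debye_phase \<nu> x)) < \<epsilon>"
proof -
  obtain F where F: "\<And>r. (F has_vector_derivative cis (r\<^sup>2)) (at r)" "\<And>r. F (- r) = - F r"
    and Flim: "(F \<longlongrightarrow> of_real (sqrt pi / 2) * cis (pi / 4)) at_top"
    using fresnel_primitive by blast
  define \<beta>0 where "\<beta>0 = arccos (1 / \<alpha>0)"
  have b0: "0 < \<beta>0" "\<beta>0 \<le> pi / 2"
    using a0 arccos_less_arccos[of "1 / \<alpha>0" 1] arccos_le_pi2[of "1 / \<alpha>0"] by (auto simp: \<beta>0_def divide_simps)
  have s0: "sin (\<beta>0 / 2) > 0" "sin \<beta>0 > 0" using b0 by (auto intro!: sin_gt_zero)
  define H where "H x = x powr (-2/5)" for x :: real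
  define E where "E x = sqrt x * (16 / (x * sin (\<beta>0 / 2) * H x) + 2 * x * H x ^ 4)" for x
  from tendstoD[OF Flim, of "\<epsilon> / 4"] e obtain R where
    R: "\<And>r. r \<ge> R \<Longrightarrow> dist (F r) (of_real (sqrt pi / 2) * cis (pi / 4)) < \<epsilon> / 4"
    by (auto simp: eventually_at_top_linorder)
  have "(E \<longlongrightarrow> 0) at_top"
    unfolding E_def H_def using s0 by real_asymp
  then have "\<forall>\<^sub>F x in at_top. E x < \<epsilon> / 2" using e by (intro order_tendstoD) auto
  moreover have "(H \<longlongrightarrow> 0) at_top" unfolding H_def by real_asymp
  then have "\<forall>\<^sub>F x in at_top. H x < min 1 \<beta>0" using b0 by (intro order_tendstoD) auto
  moreover have "filterlim (\<lambda>x. H x * sqrt (x * sin \<beta>0 / 2)) at_top at_top"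
    unfolding H_def using s0 by real_asymp
  then have "\<forall>\<^sub>F x in at_top. R \<le> H x * sqrt (x * sin \<beta>0 / 2)" by (simp add: filterlim_at_top)
  ultimately have "\<forall>\<^sub>F x in at_top. E x < \<epsilon> / 2 \<and> H x < min 1 \<beta>0 \<and> R \<le> H x * sqrt (x * sin \<beta>0 / 2)"
    by eventually_elim auto
  then obtain X0 where X0: "\<And>x. x \<ge> X0 \<Longrightarrow> E x < \<epsilon> / 2 \<and> H x < min 1 \<beta>0 \<and> R \<le> H x * sqrt (x * sin \<beta>0 / 2)"
    by (auto simp: eventually_at_top_linorder)
  show thesis
  proof (rule that[of "max X0 1"])
    fix \<nu> x :: real assume x: "max X0 1 \<le> x" and nu: "0 \<le> \<nu>" "\<alpha>0 * \<nu> \<le> x"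
    have xp: "x > 0" using x by simp
    have "\<nu> * 1 \<le> \<nu> * \<alpha>0" using nu a0 by (intro mult_left_mono) auto
    then have nux: "\<nu> \<le> x" using nu by (simp add: mult_ac)
    define \<beta> where "\<beta> = arccos (\<nu> / x)"
    have rng: "0 \<le> \<nu> / x" "\<nu> / x \<le> 1" "\<nu> / x \<le> 1 / \<alpha>0"
      using nu xp nux a0 by (auto simp: divide_simps mult_ac)
    have nueq: "\<nu> = x * cos \<beta>" using rng xp by (simp add: \<beta>_def)
    have b: "\<beta>0 \<le> \<beta>" "\<beta> \<le> pi / 2"
      unfolding \<beta>_def \<beta>0_def using rng a0 arccos_le_pi2[OF rng(1,2)] by (auto intro!: arccos_le_arccos)
    have sb: "sin \<beta> \<ge> sin \<beta>0" using b b0 by (intro sin_monotone_2pi_le) auto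
    have xs: "x * sin \<beta> = sqrt (x\<^sup>2 - \<nu>\<^sup>2)"
    proof -
      have "x\<^sup>2 - \<nu>\<^sup>2 = (x * sin \<beta>)\<^sup>2"
        unfolding nueq by (simp add: power_mult_distrib sin_squared_eq algebra_simps)
      then show ?thesis using xp s0 sb by simp
    qed
    have ph: "\<nu> * \<beta> - x * sin \<beta> = - debye_phase \<nu> x"
      by (simp add: debye_phase_def xs) (simp add: \<beta>_def)
    have h: "0 < H x" "H x \<le> 1" "H x \<le> \<beta>0" using X0[of x] x xp by (auto simp: H_def)
    define A where "A = x * sin \<beta> / 2"
    have A: "A \<ge> x * sin \<beta>0 / 2" "A \<le> x" "A \<ge> 0"
    proof -
      have "x * sin \<beta>0 \<le> x * sin \<beta>" "x * sin \<beta> \<le> x * 1" "0 \<le> x * sin \<beta>0"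
        using sb xp s0 by (auto intro!: mult_left_mono)
      then show "A \<ge> x * sin \<beta>0 / 2" "A \<le> x" "A \<ge> 0" unfolding A_def using xp by linarith+
    qed
    define I where "I = integral {0..pi} (\<lambda>t. cis (\<nu> * t - x * sin t))"
    have 1: "norm (sqrt A * I - cis (- debye_phase \<nu> x) * (2 * F (H x * sqrt A))) \<le> E x"
    proof -
      have "norm (sqrt A * I - cis (- debye_phase \<nu> x) * (2 * F (H x * sqrt A))) \<le>
         sqrt A * (16 / (x * sin (\<beta>0 / 2) * H x) + 2 * x * H x ^ 4)"
        using stationary_phase_bound[OF nueq xp b0(1) b h F] by (simp add: A_def I_def ph)
      also have "\<dots> \<le> E x"
        unfolding E_def using A xp s0 h by (intro mult_right_mono) auto
      finally show ?thesis .
    qed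
    have "R \<le> H x * sqrt A"
    proof -
      have "R \<le> H x * sqrt (x * sin \<beta>0 / 2)" using X0[of x] x by auto
      also have "\<dots> \<le> H x * sqrt A" using A h by (intro mult_left_mono) auto
      finally show ?thesis .
    qed
    from R[OF this] have "norm (2 * cis (- debye_phase \<nu> x) * (F (H x * sqrt A) - of_real (sqrt pi / 2) * cis (pi / 4))) < \<epsilon> / 2"
      by (simp add: norm_mult dist_norm)
    also have "2 * cis (- debye_phase \<nu> x) * (F (H x * sqrt A) - of_real (sqrt pi / 2) * cis (pi / 4)) =
      cis (- debye_phase \<nu> x) * (2 * F (H x * sqrt A)) - sqrt pi * cis (pi / 4 - debye_phase \<nu> x)"
      by (simp add: algebra_simps cis_mult)
    finally have 2: "norm (\<dots>) < \<epsilon> / 2" .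
    have "norm (sqrt A * I - sqrt pi * cis (pi / 4 - debye_phase \<nu> x)) < \<epsilon>"
      using norm_triangle_ineq[of "sqrt A * I - cis (- debye_phase \<nu> x) * (2 * F (H x * sqrt A))"
        "cis (- debye_phase \<nu> x) * (2 * F (H x * sqrt A)) - sqrt pi * cis (pi / 4 - debye_phase \<nu> x)"]
        1 2 X0[of x] x by simp
    then show "norm (sqrt (sqrt (x\<^sup>2 - \<nu>\<^sup>2) / 2) * integral {0..pi} (\<lambda>t. cis (\<nu> * t - x * sin t))
      - sqrt pi * cis (pi / 4 - debye_phase \<nu> x)) < \<epsilon>"
      by (simp add: A_def I_def xs)
  qed simp
qed

lemma bessel_J_asymptotic:
  assumes a0: "\<alpha>0 > 1" and e: "\<epsilon> > 0"
  obtains X where "X > 0" and "\<And>n x. x \<ge> X \<Longrightarrow> \<alpha>0 * real n \<le> x \<Longrightarrow>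
    \<bar>pi * sqrt (sqrt (x\<^sup>2 - (real n)\<^sup>2) / 2) * bessel_J n x
      - sqrt pi * cos (debye_phase (real n) x - pi / 4)\<bar> < \<epsilon>"
proof -
  obtain X where X: "X > 0" "\<And>\<nu> x. x \<ge> X \<Longrightarrow> 0 \<le> \<nu> \<Longrightarrow> \<alpha>0 * \<nu> \<le> x \<Longrightarrow>
    norm (sqrt (sqrt (x\<^sup>2 - \<nu>\<^sup>2) / 2) * integral {0..pi} (\<lambda>t. cis (\<nu> * t - x * sin t))
      - sqrt pi * cis (pi / 4 - debye_phase \<nu> x)) < \<epsilon>"
    using stationary_phase[OF a0 e] by blast
  show thesis
  proof (rule that[OF X(1)])
    fix n :: nat and x :: real
    assume *: "x \<ge> X" "\<alpha>0 * real n \<le> x"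
    let ?w = "sqrt (sqrt (x\<^sup>2 - (real n)\<^sup>2) / 2) * integral {0..pi} (\<lambda>t. cis (real n * t - x * sin t))
      - sqrt pi * cis (pi / 4 - debye_phase (real n) x)"
    have "Re ?w = pi * sqrt (sqrt (x\<^sup>2 - (real n)\<^sup>2) / 2) * bessel_J n x - sqrt pi * cos (debye_phase (real n) x - pi / 4)"
      using cos_minus[of "debye_phase (real n) x - pi / 4"] by (simp add: bessel_integral[symmetric])
    then show "\<bar>pi * sqrt (sqrt (x\<^sup>2 - (real n)\<^sup>2) / 2) * bessel_J n x
      - sqrt pi * cos (debye_phase (real n) x - pi / 4)\<bar> < \<epsilon>"
      using X(2)[OF *(1) _ *(2)] abs_Re_le_cmod[of ?w] by simp
  qed
qed

text \<open>
  The derivative of the phase with respect to \<open>x\<close> is \<open>sqrt (x\<^sup>2 - \<nu>\<^sup>2) / x\<close>, which lies in \<open>[0, 1]\<close>.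
\<close>
lemma debye_phase_lipschitz:
  assumes "0 \<le> \<nu>" "\<nu> < x" "\<nu> < y"
  shows "\<bar>debye_phase \<nu> x - debye_phase \<nu> y\<bar> \<le> \<bar>x - y\<bar>"
proof -
  have d: "(debye_phase \<nu> has_real_derivative sqrt (z\<^sup>2 - \<nu>\<^sup>2) / z) (at z within {\<nu><..})" if "z \<in> {\<nu><..}" for z
  proof -
    have z: "z > 0" "\<nu> < z" using that assms by auto
    define s where "s = sqrt (z\<^sup>2 - \<nu>\<^sup>2)"
    have zz: "z\<^sup>2 - \<nu>\<^sup>2 > 0" using z assms power_strict_mono[of \<nu> z 2] by simp
    then have s: "s > 0" and s2: "s\<^sup>2 = z\<^sup>2 - \<nu>\<^sup>2" by (auto simp: s_def)
    have q: "sqrt (1 - (\<nu> / z)\<^sup>2) = s / z"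
    proof -
      have "1 - (\<nu> / z)\<^sup>2 = (s / z)\<^sup>2" using z by (simp add: power_divide s2 field_simps)
      then show ?thesis using s z by simp
    qed
    have da: "((\<lambda>z. arccos (\<nu> / z)) has_real_derivative \<nu> / (z * s)) (at z)"
    proof -
      have "(arccos has_real_derivative inverse (- sqrt (1 - (\<nu> / z)\<^sup>2))) (at (\<nu> / z))"
        by (rule DERIV_arccos) (use z assms in \<open>auto simp: divide_simps\<close>)
      moreover have "((\<lambda>z. \<nu> / z) has_real_derivative - \<nu> / z\<^sup>2) (at z)"
        using z by (auto intro!: derivative_eq_intros simp: power2_eq_square)
      ultimately have "((\<lambda>z. arccos (\<nu> / z)) has_real_derivative inverse (- sqrt (1 - (\<nu> / z)\<^sup>2)) * (- \<nu> / z\<^sup>2)) (at z)"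
        by (rule DERIV_chain2)
      then show ?thesis unfolding q using z s by (simp add: field_simps power2_eq_square)
    qed
    have ds: "((\<lambda>z. sqrt (z\<^sup>2 - \<nu>\<^sup>2)) has_real_derivative z / s) (at z)"
      using zz by (auto intro!: derivative_eq_intros simp: s_def field_simps)
    have "(debye_phase \<nu> has_real_derivative z / s - \<nu> * (\<nu> / (z * s))) (at z)"
      unfolding debye_phase_def[abs_def] by (intro DERIV_diff ds DERIV_cmult da)
    moreover have "z / s - \<nu> * (\<nu> / (z * s)) = s / z"
    proof -
      have "z / s - \<nu> * (\<nu> / (z * s)) = (z\<^sup>2 - \<nu>\<^sup>2) / (z * s)"
        using z s by (simp add: field_simps power2_eq_square)
      also have "\<dots> = s / z"
        unfolding s2[symmetric] using z s by (simp add: power2_eq_square)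
      finally show ?thesis .
    qed
    ultimately show ?thesis by (simp add: s_def has_field_derivative_at_within)
  qed
  have "norm (debye_phase \<nu> x - debye_phase \<nu> y) \<le> 1 * norm (x - y)"
  proof (rule field_differentiable_bound[OF _ d])
    fix z assume "z \<in> {\<nu><..}"
    then have z: "z > 0" using assms by auto
    have "sqrt (z\<^sup>2 - \<nu>\<^sup>2) \<le> sqrt (z\<^sup>2)" by (intro real_sqrt_le_mono) simp
    moreover have "z\<^sup>2 \<ge> \<nu>\<^sup>2" using \<open>z \<in> {\<nu><..}\<close> assms by (intro power_mono) auto
    ultimately show "norm (sqrt (z\<^sup>2 - \<nu>\<^sup>2) / z) \<le> 1"
      using z by (simp add: divide_simps)
  qed (use assms in auto)
  then show ?thesis by simp
qed

lemma debye_phase_surj: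
  assumes "0 \<le> \<nu>" "\<nu> < B" "debye_phase \<nu> B \<le> y"
  obtains x where "x \<ge> B" "debye_phase \<nu> x = y"
proof -
  have lb: "debye_phase \<nu> x \<ge> sqrt (x\<^sup>2 - \<nu>\<^sup>2) - \<nu> * pi" if "x \<ge> B" for x
  proof -
    have "\<nu> * arccos (\<nu> / x) \<le> \<nu> * pi"
      using that assms by (intro mult_left_mono arccos_ubound) (auto simp: divide_simps)
    then show ?thesis by (simp add: debye_phase_def)
  qed
  have "filterlim (\<lambda>x. sqrt (x\<^sup>2 - \<nu>\<^sup>2) - \<nu> * pi) at_top at_top" by real_asymp
  then have "\<forall>\<^sub>F x in at_top. y \<le> sqrt (x\<^sup>2 - \<nu>\<^sup>2) - \<nu> * pi" by (simp add: filterlim_at_top)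
  then obtain b where "b \<ge> B" "y \<le> sqrt (b\<^sup>2 - \<nu>\<^sup>2) - \<nu> * pi"
    by (metis (no_types, lifting) eventually_at_top_linorder linorder_le_cases order_refl)
  with lb have b: "b \<ge> B" "debye_phase \<nu> b \<ge> y" by force+
  have "continuous_on {B..b} (debye_phase \<nu>)"
    unfolding debye_phase_def[abs_def] using assms
    by (intro continuous_intros) (auto simp: divide_simps)
  from IVT'[OF assms(3) b(2) b(1) this] that show thesis by auto
qed

section \<open>The sequence of positive zeros of a Bessel function\<close>

text \<open>
  Splitting off \<open>(x / 2)\<^sup>l\<close> leaves an entire function of \<open>(x / 2)\<^sup>2\<close> that does not vanish at \<open>0\<close>. This
  gives access to the identity theorem.
\<close>
lemma bessel_J_entire_factor:
  obtains g where "g holomorphic_on UNIV" "g 0 \<noteq> 0"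
    "\<And>x. of_real (bessel_J l x) = of_real ((x / 2) ^ l) * g (of_real ((x / 2)\<^sup>2))"
proof -
  define c :: "nat \<Rightarrow> complex" where "c m = (-1) ^ m / (fact m * fact (m + l))" for m
  define g where "g w = (\<Sum>m. c m * w ^ m)" for w
  have sm: "summable (\<lambda>m. c m * w ^ m)" for w
  proof (rule summable_comparison_test')
    show "summable (\<lambda>m. inverse (fact m) * norm w ^ m)"
      using summable_exp[of "norm w"] by simp
    fix m
    have "norm (c m) \<le> inverse (fact m)"
      using fact_ge_1[of "m + l", where 'a = real]
      by (simp add: c_def norm_divide norm_mult norm_power divide_simps)
    then show "norm (c m * w ^ m) \<le> inverse (fact m) * norm w ^ m"
      by (simp add: norm_mult norm_power mult_right_mono)
  qed
  have hol: "g holomorphic_on ball 0 r" for r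
    by (rule power_series_holomorphic[where a = c]) (use sm in \<open>auto simp: g_def intro: summable_sums\<close>)
  have "g field_differentiable at z" for z
    by (rule holomorphic_on_imp_differentiable_at[OF hol[of "norm z + 1"]]) auto
  then have 1: "g holomorphic_on UNIV"
    by (simp add: holomorphic_on_def)
  have 2: "g 0 \<noteq> 0" using powser_zero[of c] by (simp add: g_def c_def)
  have "of_real (bessel_J l x) = of_real ((x / 2) ^ l) * g (of_real ((x / 2)\<^sup>2))" for x
  proof -
    have e: "of_real ((x / 2) ^ l) * (c m * of_real ((x / 2)\<^sup>2) ^ m) =
        of_real ((- 1) ^ m / (fact m * fact (m + l)) * (x / 2) ^ (2 * m + l))" for m
      by (simp add: c_def power_add power_mult)
    have "(\<lambda>m. of_real ((x / 2) ^ l) * (c m * of_real ((x / 2)\<^sup>2) ^ m)) sums (of_real ((x / 2) ^ l) * g (of_real ((x / 2)\<^sup>2)))"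
      unfolding g_def by (intro sums_mult summable_sums sm)
    then have s: "(\<lambda>m. of_real ((- 1) ^ m / (fact m * fact (m + l)) * (x / 2) ^ (2 * m + l))) sums
        (of_real ((x / 2) ^ l) * g (of_real ((x / 2)\<^sup>2)))"
      by (simp only: e)
    from sums_Re[OF s] have "bessel_J l x = Re (of_real ((x / 2) ^ l) * g (of_real ((x / 2)\<^sup>2)))"
      unfolding bessel_J_def Re_complex_of_real by (rule sums_unique[symmetric])
    moreover have "Im (of_real ((x / 2) ^ l) * g (of_real ((x / 2)\<^sup>2))) = 0"
      using sums_Im[OF s] sums_unique2[OF _ sums_zero] by (simp only: Im_complex_of_real)
    ultimately show ?thesis by (simp only: complex_eq_iff Re_complex_of_real Im_complex_of_real)
  qed
  with 1 2 show thesis by (rule that)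
qed

lemma continuous_on_bessel_J: "continuous_on S (bessel_J l)"
proof -
  obtain g where g: "g holomorphic_on UNIV"
    and J: "\<And>x. of_real (bessel_J l x) = of_real ((x / 2) ^ l) * g (of_real ((x / 2)\<^sup>2))"
    using bessel_J_entire_factor by blast
  have "bessel_J l = (\<lambda>x. Re (of_real ((x / 2) ^ l) * g (of_real ((x / 2)\<^sup>2))))"
    by (rule ext) (simp only: J[symmetric] Re_complex_of_real)
  moreover have "continuous_on S (\<lambda>x. g (of_real ((x / 2)\<^sup>2)))"
    by (rule continuous_on_compose2[OF holomorphic_on_imp_continuous_on[OF g]]) (auto intro!: continuous_intros)
  ultimately show ?thesis by (auto intro!: continuous_intros simp del: times_complex.sel)
qed

text \<open>
  Positive zeros of \<open>J\<^sub>l\<close> correspond to zeros of the entire factor, which are isolated unless that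
  factor is constant; a constant factor is nonzero and then there are no positive zeros at all.
\<close>
lemma finite_bessel_zeros_le: "finite {y. 0 < y \<and> bessel_J l y = 0 \<and> y \<le> R}"
proof -
  obtain g where g: "g holomorphic_on UNIV" "g 0 \<noteq> 0"
    and J: "\<And>x. of_real (bessel_J l x) = of_real ((x / 2) ^ l) * g (of_real ((x / 2)\<^sup>2))"
    using bessel_J_entire_factor by blast
  have z: "bessel_J l y = 0 \<longleftrightarrow> g (of_real ((y / 2)\<^sup>2)) = 0" if "y > 0" for y
  proof -
    have "bessel_J l y = 0 \<longleftrightarrow> complex_of_real (bessel_J l y) = 0" by simp
    then show ?thesis unfolding J using that by simp
  qed
  show ?thesis
  proof (cases "g constant_on UNIV")
    case True
    then have "g w \<noteq> 0" for w using g(2) unfolding constant_on_def by (metis UNIV_I)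
    then have "{y. 0 < y \<and> bessel_J l y = 0 \<and> y \<le> R} = {}" using z by auto
    then show ?thesis by (simp only: finite.emptyI)
  next
    case False
    have "finite {w \<in> cball 0 ((R / 2)\<^sup>2). g w = 0}"
      by (rule holomorphic_compact_finite_zeros[OF g(1) _ _ _ _ False]) auto
    moreover have "(\<lambda>y. complex_of_real ((y / 2)\<^sup>2)) ` {y. 0 < y \<and> bessel_J l y = 0 \<and> y \<le> R} \<subseteq> {w \<in> cball 0 ((R / 2)\<^sup>2). g w = 0}"
    proof safe
      fix y assume y: "0 < y" "bessel_J l y = 0" "y \<le> R"
      show "g (of_real ((y / 2)\<^sup>2)) = 0" using z y by blast
      have "(y / 2)\<^sup>2 \<le> (R / 2)\<^sup>2" using y by (intro power_mono) auto
      then show "complex_of_real ((y / 2)\<^sup>2) \<in> cball 0 ((R / 2)\<^sup>2)"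
        by (simp only: mem_cball dist_norm norm_minus_cancel diff_0 norm_of_real abs_of_nonneg zero_le_power2)
    qed
    moreover have "inj_on (\<lambda>y. complex_of_real ((y / 2)\<^sup>2)) {y. 0 < y \<and> bessel_J l y = 0 \<and> y \<le> R}"
      by (rule inj_onI) (auto simp: power_divide simp flip: of_real_power of_real_divide dest: power2_eq_imp_eq)
    ultimately show ?thesis by (meson finite_imageD finite_subset)
  qed
qed

lemma locally_finite_count_exists:
  fixes Z :: "real set"
  assumes fin: "\<And>x. finite {y \<in> Z. y \<le> x}" and inf: "infinite Z"
    and pos: "\<And>y. y \<in> Z \<Longrightarrow> 0 < y" and "k \<ge> 1"
  shows "\<exists>x\<in>Z. card {y \<in> Z. y \<le> x} = k"
proof -
  have next_elem: "\<exists>z\<in>Z. card {y \<in> Z. y \<le> z} = Suc (card {y \<in> Z. y \<le> x})" for x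
  proof -
    have "\<not> Z \<subseteq> {y \<in> Z. y \<le> x}" using fin inf finite_subset by blast
    then obtain w where w: "w \<in> Z" "x < w" by force
    define S where "S = {y \<in> Z. y \<le> w} - {y \<in> Z. y \<le> x}"
    have S: "finite S" "S \<noteq> {}" unfolding S_def using fin w by auto
    define z where "z = Min S"
    have zS: "z \<in> S" unfolding z_def using S by (rule Min_in)
    have "{y \<in> Z. y \<le> z} = insert z {y \<in> Z. y \<le> x}"
    proof (intro equalityI subsetI)
      fix y assume y: "y \<in> {y \<in> Z. y \<le> z}"
      show "y \<in> insert z {y \<in> Z. y \<le> x}"
      proof (cases "y \<le> x")
        case False
        then have "y \<in> S" using y zS by (auto simp: S_def)
        then have "z \<le> y" unfolding z_def using S by simp
        then show ?thesis using y by auto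
      qed (use y in auto)
    qed (use zS in \<open>auto simp: S_def\<close>)
    moreover have "z \<notin> {y \<in> Z. y \<le> x}" "z \<in> Z" using zS by (auto simp: S_def)
    ultimately show ?thesis using fin by (intro bexI[of _ z]) auto
  qed
  have *: "\<exists>x\<in>Z. card {y \<in> Z. y \<le> x} = Suc j" for j
  proof (induction j)
    case 0
    have "{y \<in> Z. y \<le> 0} = {}" using pos by force
    then show ?case using next_elem[of 0] by (simp only: card.empty)
  next
    case (Suc j)
    then show ?case using next_elem by metis
  qed
  then show ?thesis using *[of "k - 1"] \<open>k \<ge> 1\<close> by simp
qed

text \<open>
  For large \<open>x\<close>, where the phase minus \<open>\<pi> / 4\<close> is an even multiple of \<open>\<pi>\<close>, the leading term forces \<open>J\<^sub>l\<close> to be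
  positive, and where it is an odd multiple, negative. Both happen arbitrarily far out, so there is
  a zero beyond any bound.
\<close>
lemma infinite_bessel_zeros: "infinite {y. 0 < y \<and> bessel_J l y = 0}"
proof
  assume fin: "finite {y. 0 < y \<and> bessel_J l y = 0}"
  obtain X where X: "X > 0" "\<And>n x. x \<ge> X \<Longrightarrow> 2 * real n \<le> x \<Longrightarrow>
    \<bar>pi * sqrt (sqrt (x\<^sup>2 - (real n)\<^sup>2) / 2) * bessel_J n x
      - sqrt pi * cos (debye_phase (real n) x - pi / 4)\<bar> < sqrt pi"
    using bessel_J_asymptotic[of 2 "sqrt pi"] by auto
  define B where "B = Max (insert (X + 2 * real l) {y. 0 < y \<and> bessel_J l y = 0}) + 1"
  have B: "B \<ge> X + 2 * real l + 1" unfolding B_def using fin by simp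
  have nz: "bessel_J l x \<noteq> 0" if "x \<ge> B" for x
  proof
    assume "bessel_J l x = 0"
    moreover have "x > 0" using that B X(1) by simp
    ultimately have "x \<le> B - 1" unfolding B_def using fin by simp
    then show False using that by simp
  qed
  have amp: "pi * sqrt (sqrt (x\<^sup>2 - (real l)\<^sup>2) / 2) > 0" if "x \<ge> B" for x
    using that B X(1) power_strict_mono[of "real l" x 2] by simp
  have sgn: "bessel_J l x > 0" if "x \<ge> B" "cos (debye_phase l x - pi / 4) = 1" for x
  proof -
    have "pi * sqrt (sqrt (x\<^sup>2 - (real l)\<^sup>2) / 2) * bessel_J l x > 0"
      using X(2)[of x l] that B X(1) by (simp add: abs_less_iff)
    then show ?thesis using amp[OF that(1)] by (simp only: zero_less_mult_pos)
  qed
  have sgn': "bessel_J l x < 0" if "x \<ge> B" "cos (debye_phase l x - pi / 4) = -1" for x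
  proof -
    have "pi * sqrt (sqrt (x\<^sup>2 - (real l)\<^sup>2) / 2) * (- bessel_J l x) > 0"
      using X(2)[of x l] that B X(1) by (simp add: abs_less_iff)
    then have "- bessel_J l x > 0" using amp[OF that(1)] by (rule zero_less_mult_pos)
    then show ?thesis by simp
  qed
  obtain m :: nat where m: "debye_phase l B \<le> real m"
    using real_arch_simple by blast
  have m': "debye_phase l B \<le> real (2 * m) * pi + pi / 4" "debye_phase l B \<le> real (2 * m + 1) * pi + pi / 4"
  proof -
    have "real m \<le> real (2 * m) * pi" using pi_ge_two mult_left_mono[of 1 "2 * pi" "real m"] by simp
    then show "debye_phase l B \<le> real (2 * m) * pi + pi / 4" using m pi_gt_zero by linarith
    moreover have "real (2 * m + 1) * pi = real (2 * m) * pi + pi" by (simp add: distrib_right)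
    ultimately show "debye_phase l B \<le> real (2 * m + 1) * pi + pi / 4"
      using pi_gt_zero by linarith
  qed
  have lB: "real l < B" using B X(1) by simp
  obtain x1 where x1: "x1 \<ge> B" "debye_phase l x1 = real (2 * m) * pi + pi / 4"
    using debye_phase_surj[OF _ lB m'(1)] by auto
  obtain x2 where x2: "x2 \<ge> B" "debye_phase l x2 = real (2 * m + 1) * pi + pi / 4"
    using debye_phase_surj[OF _ lB m'(2)] by auto
  have "bessel_J l x1 > 0"
    using x1 by (intro sgn) (simp_all del: of_nat_mult)
  moreover have "bessel_J l x2 < 0"
  proof (rule sgn'[OF x2(1)])
    show "cos (debye_phase l x2 - pi / 4) = -1"
      unfolding x2(2) using cos_npi[of "2 * m + 1"] by (simp only: add_diff_cancel_right') simp
  qed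
  moreover have "connected (bessel_J l ` {B..})"
    by (intro connected_continuous_image continuous_on_bessel_J) simp
  ultimately have "0 \<in> bessel_J l ` {B..}"
    using x1 x2 connectedD_interval[of "bessel_J l ` {B..}" "bessel_J l x2" "bessel_J l x1" 0] by force
  then show False using nz by auto
qed

text \<open>
  The zeros are unbounded and finite in number below any bound, so counting them assigns each
  \<open>k \<ge> 1\<close> to exactly one zero, and the definite description in the definition of \<open>bessel_zero\<close> is
  meaningful.
\<close>
lemma bessel_zero_props:
  assumes "k \<ge> 1"
  shows "bessel_zero l k > 0" "bessel_J l (bessel_zero l k) = 0"
    "card {y. 0 < y \<and> y \<le> bessel_zero l k \<and> bessel_J l y = 0} = k"
proof -
  define Z where "Z = {y. 0 < y \<and> bessel_J l y = 0}"
  have eq: "{y. 0 < y \<and> y \<le> x \<and> bessel_J l y = 0} = {y \<in> Z. y \<le> x}" for x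
    by (auto simp: Z_def)
  have fin: "finite {y \<in> Z. y \<le> x}" for x
    using finite_bessel_zeros_le[of l x] by (simp add: Z_def conj_ac)
  have inf: "infinite Z" unfolding Z_def by (rule infinite_bessel_zeros)
  have pos: "y > 0" if "y \<in> Z" for y using that by (simp add: Z_def)
  obtain z where z: "z \<in> Z" "card {y \<in> Z. y \<le> z} = k"
    using locally_finite_count_exists[OF fin inf pos assms] by blast
  have lt: "card {y \<in> Z. y \<le> x} < card {y \<in> Z. y \<le> x'}" if "x' \<in> Z" "x < x'" for x x'
    using that by (intro psubset_card_mono fin) force
  have "bessel_zero l k = z"
    unfolding bessel_zero_def eq
  proof (rule the_equality)
    show "0 < z \<and> bessel_J l z = 0 \<and> card {y \<in> Z. y \<le> z} = k" using z by (auto simp: Z_def)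
    fix x assume x: "0 < x \<and> bessel_J l x = 0 \<and> card {y \<in> Z. y \<le> x} = k"
    then have "x \<in> Z" by (simp add: Z_def)
    then show "x = z" using lt[of x z] lt[of z x] x z by (metis less_irrefl linorder_neqE)
  qed
  then show "bessel_zero l k > 0" "bessel_J l (bessel_zero l k) = 0"
    "card {y. 0 < y \<and> y \<le> bessel_zero l k \<and> bessel_J l y = 0} = k"
    using z unfolding eq by (auto simp: Z_def)
qed

lemma finite_bessel_zeros_pairs: "finite {(l, k). k \<ge> 1 \<and> real l \<le> M \<and> bessel_zero l k \<le> R}"
proof -
  have one: "finite {k. k \<ge> 1 \<and> bessel_zero l k \<le> R}" for l
  proof (rule inj_on_finite[where B = "{y. 0 < y \<and> bessel_J l y = 0 \<and> y \<le> R}"])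
    show "inj_on (bessel_zero l) {k. k \<ge> 1 \<and> bessel_zero l k \<le> R}"
      using bessel_zero_props(3) by (intro inj_onI) (metis mem_Collect_eq)
    show "bessel_zero l ` {k. k \<ge> 1 \<and> bessel_zero l k \<le> R} \<subseteq> {y. 0 < y \<and> bessel_J l y = 0 \<and> y \<le> R}"
      using bessel_zero_props by auto
  qed (rule finite_bessel_zeros_le)
  have "finite (SIGMA l:{..nat \<lfloor>M\<rfloor>}. {k. k \<ge> 1 \<and> bessel_zero l k \<le> R})"
    by (intro finite_SigmaI one) auto
  moreover have "{(l, k). k \<ge> 1 \<and> real l \<le> M \<and> bessel_zero l k \<le> R} \<subseteq> (SIGMA l:{..nat \<lfloor>M\<rfloor>}. {k. k \<ge> 1 \<and> bessel_zero l k \<le> R})"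
    by (auto simp: le_nat_floor)
  ultimately show ?thesis by (rule rev_finite_subset)
qed

section \<open>No zeros near the critical ray\<close>

text \<open>
  A zero would mean \<open>4 n q2 = q1 (2 i + 1)\<close> for an (odd) integer \<open>i\<close>. The factor \<open>2 i + 1\<close> is odd,
  so \<open>4\<close> would divide \<open>q1\<close>.
\<close>
lemma cos_phase_ne_zero:
  assumes "q1 \<ge> 1" "q2 \<ge> 1" "\<not> 4 dvd q1"
  shows "cos (real n * (pi * real q2 / real q1) - pi / 4) \<noteq> 0"
proof
  assume "cos (real n * (pi * real q2 / real q1) - pi / 4) = 0"
  then obtain i :: int where i: "odd i" "real n * (pi * real q2 / real q1) - pi / 4 = of_int i * (pi / 2)"
    unfolding cos_zero_iff_int by blast
  have "pi * (real n * real q2 / real q1 - 1 / 4) = pi * (of_int i / 2)"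
    using i(2) by (simp add: algebra_simps)
  then have "real n * real q2 / real q1 - 1 / 4 = of_int i / 2" by simp
  then have "4 * real n * real q2 = real q1 * (2 * of_int i + 1)"
    using assms by (simp add: field_simps)
  then have "(of_int (4 * int n * int q2) :: real) = of_int (int q1 * (2 * i + 1))" by simp
  then have "4 * int n * int q2 = int q1 * (2 * i + 1)" by (simp only: of_int_eq_iff)
  then have "4 dvd int q1 * (2 * i + 1)" by (metis dvd_triv_left mult.assoc)
  moreover have "coprime (2 ^ 2 :: int) (2 * i + 1)"
    unfolding coprime_power_left_iff by simp
  then have "coprime 4 (2 * i + 1)" by simp
  ultimately have "4 dvd int q1" by (simp add: coprime_dvd_mult_left_iff)
  then have "4 dvd q1" by presburger
  with assms show False by simp
qed

text \<open>
  Replacing \<open>n\<close> by \<open>n + q1\<close> changes the argument by \<open>q2 \<pi>\<close>, which preserves the absolute value of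
  the cosine; hence only finitely many values occur, all of them positive.
\<close>
lemma cos_phase_bounded_below:
  assumes "q1 \<ge> 1" "q2 \<ge> 1" "\<not> 4 dvd q1"
  obtains \<epsilon> where "\<epsilon> > 0" "\<And>n::nat. \<bar>cos (real n * (pi * real q2 / real q1) - pi / 4)\<bar> \<ge> \<epsilon>"
proof -
  define f where "f n = \<bar>cos (real n * (pi * real q2 / real q1) - pi / 4)\<bar>" for n :: nat
  define \<epsilon> where "\<epsilon> = Min (f ` {..<q1})"
  have per: "f n = f (n mod q1)" for n
  proof -
    have "real n = real q1 * real (n div q1) + real (n mod q1)"
      by (simp flip: of_nat_mult of_nat_add)
    then have "real n * (pi * real q2 / real q1) - pi / 4
        = (real (n mod q1) * (pi * real q2 / real q1) - pi / 4) + real (n div q1 * q2) * pi"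
      using assms by (simp add: field_simps)
    then show ?thesis
      unfolding f_def by (simp only: cos_add cos_npi sin_npi) (simp add: abs_mult power_abs)
  qed
  have ne: "f ` {..<q1} \<noteq> {}" using assms by (auto simp: lessThan_empty_iff)
  have "\<epsilon> > 0"
    unfolding \<epsilon>_def using cos_phase_ne_zero[OF assms] ne by (subst Min_gr_iff) (auto simp: f_def)
  moreover have "f n \<ge> \<epsilon>" for n
    unfolding per[of n] \<epsilon>_def using assms by (intro Min_le) auto
  ultimately show thesis using that by (auto simp: f_def)
qed

text \<open>
  On the ray the leading term has modulus at least \<open>\<epsilon>\<close> (in units of \<open>sqrt pi\<close>). Moving by less than
  \<open>\<epsilon> / 2\<close> changes the phase, and so the cosine, by less than \<open>\<epsilon> / 2\<close>, and the error of the asymptotics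
  is below \<open>\<epsilon> / 2\<close>.
\<close>
lemma no_bessel_zeros_near_ray:
  assumes a: "\<alpha> > 1" and q: "q1 \<ge> 1" "q2 \<ge> 1" "\<not> 4 dvd q1" and s: "sigma_of \<alpha> = real q1 / real q2"
  obtains \<delta> L where "\<delta> > 0" and "\<And>n x. real n \<ge> L \<Longrightarrow> \<bar>x - \<alpha> * real n\<bar> < \<delta> \<Longrightarrow> bessel_J n x \<noteq> 0"
proof -
  obtain \<epsilon> where e: "\<epsilon> > 0" "\<And>n::nat. \<bar>cos (real n * (pi * real q2 / real q1) - pi / 4)\<bar> \<ge> \<epsilon>"
    using cos_phase_bounded_below[OF q] by blast
  \<comment> \<open>A slope strictly between \<open>1\<close> and \<open>\<alpha>\<close>, so that
     the window around \<open>\<alpha> n\<close> stays in the region of validity of the asymptotics.\<close>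
  define \<alpha>0 where "\<alpha>0 = (1 + \<alpha>) / 2"
  have a0: "\<alpha>0 > 1" using a by (simp add: \<alpha>0_def)
  obtain X where X: "X > 0" "\<And>n x. x \<ge> X \<Longrightarrow> \<alpha>0 * real n \<le> x \<Longrightarrow>
    \<bar>pi * sqrt (sqrt (x\<^sup>2 - (real n)\<^sup>2) / 2) * bessel_J n x
      - sqrt pi * cos (debye_phase (real n) x - pi / 4)\<bar> < sqrt pi * (\<epsilon> / 2)"
    using bessel_J_asymptotic[OF a0, of "sqrt pi * (\<epsilon> / 2)"] e by auto
  define \<delta> where "\<delta> = min 1 (\<epsilon> / 2)"
  \<comment> \<open>The second entry makes \<open>\<alpha> n - 1 \<ge> \<alpha>0 n\<close> for \<open>n \<ge> L\<close>, since \<open>\<alpha> - \<alpha>0 = (\<alpha> - 1) / 2\<close>.\<close>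
  define L where "L = max (X + 1) (2 / (\<alpha> - 1))"
  have ray: "debye_phase (real n) (\<alpha> * real n) = real n * (pi * real q2 / real q1)" for n
  proof (cases "n = 0")
    case False
    have "sqrt ((\<alpha> * real n)\<^sup>2 - (real n)\<^sup>2) = real n * sqrt (\<alpha>\<^sup>2 - 1)"
    proof -
      have "(\<alpha> * real n)\<^sup>2 - (real n)\<^sup>2 = (real n)\<^sup>2 * (\<alpha>\<^sup>2 - 1)"
        by (simp add: power_mult_distrib algebra_simps)
      then show ?thesis by (simp add: real_sqrt_mult)
    qed
    then have "debye_phase (real n) (\<alpha> * real n) = real n * (sqrt (\<alpha>\<^sup>2 - 1) - arccos (1 / \<alpha>))"
      using False by (simp add: debye_phase_def algebra_simps)
    also have "sqrt (\<alpha>\<^sup>2 - 1) - arccos (1 / \<alpha>) = pi * real q2 / real q1"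
    proof -
      have "sqrt (\<alpha>\<^sup>2 - 1) - arccos (1 / \<alpha>) \<noteq> 0" using s q by (auto simp: sigma_of_def)
      then show ?thesis using s q by (simp add: sigma_of_def field_simps)
    qed
    finally show ?thesis .
  qed (simp add: debye_phase_def)
  show thesis
  proof (rule that)
    show "\<delta> > 0" using e by (simp add: \<delta>_def)
    fix n :: nat and x :: real assume n: "real n \<ge> L" and x: "\<bar>x - \<alpha> * real n\<bar> < \<delta>"
    show "bessel_J n x \<noteq> 0"
    proof
      assume J: "bessel_J n x = 0"
      have "real n \<ge> 2 / (\<alpha> - 1)" using n by (simp add: L_def)
      then have an: "real n * (\<alpha> - 1) \<ge> 2" using a by (simp add: field_simps)
      have x1: "x > \<alpha> * real n - 1" using x unfolding \<delta>_def by linarith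
      have nx: "real n < x" using x1 an by (simp add: algebra_simps)
      have 1: "\<alpha>0 * real n \<le> x" using x1 an by (simp add: \<alpha>0_def field_simps)
      have nX: "real n \<ge> X + 1" using n by (simp add: L_def)
      have "x \<ge> X" using nx nX by simp
      from X(2)[OF this 1] J have "sqrt pi * \<bar>cos (debye_phase (real n) x - pi / 4)\<bar> < sqrt pi * (\<epsilon> / 2)"
        by (simp add: abs_mult)
      then have small: "\<bar>cos (debye_phase (real n) x - pi / 4)\<bar> < \<epsilon> / 2" by simp
      have "real n < \<alpha> * real n" using an by (simp add: algebra_simps)
      from debye_phase_lipschitz[OF _ nx this]
      have "\<bar>debye_phase (real n) x - debye_phase (real n) (\<alpha> * real n)\<bar> < \<epsilon> / 2"
        using x by (simp add: \<delta>_def)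
      moreover have "\<bar>cos u - cos v\<bar> \<le> \<bar>u - v\<bar>" for u v :: real
        using abs_Re_le_cmod[of "cis u - cis v"] norm_cis_diff_le[of u v] by simp
      from this[of "debye_phase (real n) x - pi / 4" "debye_phase (real n) (\<alpha> * real n) - pi / 4"]
      have "\<bar>cos (debye_phase (real n) x - pi / 4) - cos (debye_phase (real n) (\<alpha> * real n) - pi / 4)\<bar>
         \<le> \<bar>debye_phase (real n) x - debye_phase (real n) (\<alpha> * real n)\<bar>" by simp
      ultimately show False using small e(2)[of n] unfolding ray[symmetric] by linarith
    qed
  qed
qed

section \<open>Consequences for the eigenvalues\<close>

text \<open>
  For \<open>l \<ge> L\<close> the gap gives \<open>\<delta> (j + \<alpha> l) \<le> M\<close>, which bounds both \<open>j\<close> and \<open>l\<close>; for \<open>l < L\<close> the zero is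
  bounded because \<open>j\<^sup>2 \<le> M + \<alpha>\<^sup>2 L\<^sup>2\<close>.
\<close>
lemma finite_bounded_eigenvalue_pairs:
  assumes a: "\<alpha> > 1" and d: "\<delta> > 0"
    and sep: "\<And>n x. real n \<ge> L \<Longrightarrow> \<bar>x - \<alpha> * real n\<bar> < \<delta> \<Longrightarrow> bessel_J n x \<noteq> 0"
  shows "finite {(l, k). k \<ge> 1 \<and> \<bar>eigenvalue \<alpha> l k\<bar> \<le> M}"
proof -
  \<comment> \<open>A common bound for \<open>j\<close> in both cases: \<open>M / \<delta> \<le> R\<close>, and
     \<open>j \<le> j\<^sup>2 + 1 \<le> R\<close> when \<open>l < L\<close>.\<close>
  define R where "R = M / \<delta> + \<bar>M\<bar> + \<alpha>\<^sup>2 * L\<^sup>2 + 1"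
  have "real l \<le> max L (M / \<delta>) \<and> bessel_zero l k \<le> R" if k: "k \<ge> 1" and M: "\<bar>eigenvalue \<alpha> l k\<bar> \<le> M" for l k
  proof -
    define j where "j = bessel_zero l k"
    have j: "j > 0" "bessel_J l j = 0" using bessel_zero_props[OF k] by (auto simp: j_def)
    have M0: "M \<ge> 0" using M by simp
    have ev: "eigenvalue \<alpha> l k = (j - \<alpha> * real l) * (j + \<alpha> * real l)"
      by (simp add: eigenvalue_def j_def power2_eq_square algebra_simps)
    show ?thesis
    proof (cases "real l \<ge> L")
      case True
      then have "\<bar>j - \<alpha> * real l\<bar> \<ge> \<delta>" using sep[of l j] j(2) by linarith
      then have "\<delta> * (j + \<alpha> * real l) \<le> \<bar>eigenvalue \<alpha> l k\<bar>"
        unfolding ev abs_mult using a j by (intro mult_mono) auto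
      then have *: "j + \<alpha> * real l \<le> M / \<delta>" using M d by (simp add: field_simps)
      moreover have "real l \<le> \<alpha> * real l" using a by (simp add: mult_le_cancel_right1)
      ultimately have "real l \<le> M / \<delta>" using j by linarith
      moreover have "j \<le> M / \<delta>" using * a by (smt (verit) mult_nonneg_nonneg of_nat_0_le_iff)
      moreover have "\<alpha>\<^sup>2 * L\<^sup>2 \<ge> 0" by simp
      ultimately show ?thesis unfolding R_def j_def[symmetric] by linarith
    next
      case False
      have "j\<^sup>2 = eigenvalue \<alpha> l k + \<alpha>\<^sup>2 * (real l)\<^sup>2" by (simp add: eigenvalue_def j_def)
      also have "\<dots> \<le> M + \<alpha>\<^sup>2 * L\<^sup>2"
        using M False by (intro add_mono mult_left_mono power_mono) auto
      finally have "j\<^sup>2 \<le> M + \<alpha>\<^sup>2 * L\<^sup>2" .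
      moreover have "j \<le> j\<^sup>2 + 1" using j by (smt (verit) self_le_power zero_less_numeral zero_le_power2)
      moreover have "M / \<delta> \<ge> 0" using M0 d by simp
      ultimately show ?thesis using False unfolding R_def j_def[symmetric] by linarith
    qed
  qed
  then have "{(l, k). k \<ge> 1 \<and> \<bar>eigenvalue \<alpha> l k\<bar> \<le> M} \<subseteq> {(l, k). k \<ge> 1 \<and> real l \<le> max L (M / \<delta>) \<and> bessel_zero l k \<le> R}"
    by auto
  then show ?thesis using finite_bessel_zeros_pairs by (rule finite_subset)
qed

text \<open>
  Where \<open>\<bar>j - \<alpha> l\<bar> \<ge> \<delta>\<close>, the constant \<open>\<delta>\<close> works. The remaining pairs have \<open>l < L\<close> and
  \<open>j < \<alpha> L + \<delta>\<close>; there are finitely many of them, and \<open>c\<close> is the minimum of \<open>\<delta>\<close> and the nonzero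
  quotients that they contribute.
\<close>
lemma eigenvalue_gap:
  assumes a: "\<alpha> > 1" and d: "\<delta> > 0"
    and sep: "\<And>n x. real n \<ge> L \<Longrightarrow> \<bar>x - \<alpha> * real n\<bar> < \<delta> \<Longrightarrow> bessel_J n x \<noteq> 0"
  shows "\<exists>c>0. \<forall>l k. k \<ge> 1 \<longrightarrow> eigenvalue \<alpha> l k = 0 \<or> \<bar>eigenvalue \<alpha> l k\<bar> \<ge> c * bessel_zero l k"
proof -
  define P where "P = {(l, k). k \<ge> 1 \<and> real l \<le> L \<and> bessel_zero l k \<le> \<alpha> * L + \<delta>}"
  define V where "V = (\<lambda>(l, k). \<bar>eigenvalue \<alpha> l k\<bar> / bessel_zero l k) ` {p \<in> P. eigenvalue \<alpha> (fst p) (snd p) \<noteq> 0}"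
  have "finite P" unfolding P_def by (rule finite_bessel_zeros_pairs)
  then have finV: "finite V" unfolding V_def by simp
  have posV: "v > 0" if "v \<in> V" for v
    using that bessel_zero_props(1) by (auto simp: V_def P_def)
  define c where "c = Min (insert \<delta> V)"
  have c: "c > 0" unfolding c_def using finV posV d by simp
  have cV: "c \<le> v" if "v \<in> V" for v unfolding c_def using finV that by simp
  have cd: "c \<le> \<delta>" unfolding c_def using finV by simp
  have "eigenvalue \<alpha> l k = 0 \<or> \<bar>eigenvalue \<alpha> l k\<bar> \<ge> c * bessel_zero l k" if k: "k \<ge> 1" for l k
  proof -
    define j where "j = bessel_zero l k"
    have j: "j > 0" "bessel_J l j = 0" using bessel_zero_props[OF k] by (auto simp: j_def)
    have ev: "eigenvalue \<alpha> l k = (j - \<alpha> * real l) * (j + \<alpha> * real l)"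
      by (simp add: eigenvalue_def j_def power2_eq_square algebra_simps)
    show ?thesis
    proof (cases "\<bar>j - \<alpha> * real l\<bar> \<ge> \<delta>")
      case True
      have "c * j \<le> \<bar>j - \<alpha> * real l\<bar> * \<bar>j + \<alpha> * real l\<bar>"
        using True cd c a j by (intro mult_mono) auto
      then show ?thesis unfolding ev abs_mult j_def[symmetric] by simp
    next
      case False
      then have l: "real l < L" using sep[of l j] j(2) by linarith
      have "\<alpha> * real l \<le> \<alpha> * L" using l a by (intro mult_left_mono) auto
      then have "(l, k) \<in> P" using False l k by (auto simp: P_def j_def[symmetric])
      then have "eigenvalue \<alpha> l k = 0 \<or> \<bar>eigenvalue \<alpha> l k\<bar> / j \<in> V"
        unfolding V_def j_def by force
      then show ?thesis using cV[of "\<bar>eigenvalue \<alpha> l k\<bar> / j"] j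
        by (auto simp: j_def[symmetric] pos_le_divide_eq)
    qed
  qed
  with c show ?thesis by blast
qed

theorem theorem1p3:
  fixes \<alpha> :: real and q1 q2 :: nat
  assumes "\<alpha> > 1"
    and "q1 \<ge> 1" and "q2 \<ge> 1" and "coprime q1 q2"
    and "sigma_of \<alpha> = real q1 / real q2"
    and "\<not> 4 dvd q1 \<or> even q2"
  shows "(\<forall>\<mu>\<in>Spec \<alpha>. finite_multiplicity \<alpha> \<mu>) \<and>
    (\<exists>c>0. \<forall>l k. k \<ge> 1 \<longrightarrow>
       eigenvalue \<alpha> l k = 0 \<or> \<bar>eigenvalue \<alpha> l k\<bar> \<ge> c * bessel_zero l k) \<and>
    (\<forall>\<mu>. \<not> \<mu> islimpt Spec \<alpha>)"
proof -
  have q1: "\<not> 4 dvd q1"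
  proof
    assume "4 dvd q1"
    then have "even q1" "even q2" using assms(6) by (auto elim: dvd_trans[rotated])
    then show False using assms(4) coprime_common_divisor by fastforce
  qed
  obtain \<delta> L where d: "\<delta> > 0" and sep: "\<And>n x. real n \<ge> L \<Longrightarrow> \<bar>x - \<alpha> * real n\<bar> < \<delta> \<Longrightarrow> bessel_J n x \<noteq> 0"
    using no_bessel_zeros_near_ray[OF assms(1-3) q1 assms(5)] by blast
  note fin = finite_bounded_eigenvalue_pairs[OF assms(1) d sep]
  have "finite_multiplicity \<alpha> \<mu>" for \<mu>
    unfolding finite_multiplicity_def by (rule finite_subset[OF _ fin[where M = "\<bar>\<mu>\<bar>"]]) auto
  moreover have "\<not> \<mu> islimpt Spec \<alpha>" for \<mu>
  proof
    assume "\<mu> islimpt Spec \<alpha>"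
    then have "infinite (Spec \<alpha> \<inter> ball \<mu> 1)"
      unfolding islimpt_eq_infinite_ball by simp
    moreover have "Spec \<alpha> \<inter> ball \<mu> 1 \<subseteq> (\<lambda>(l, k). eigenvalue \<alpha> l k) ` {(l, k). k \<ge> 1 \<and> \<bar>eigenvalue \<alpha> l k\<bar> \<le> \<bar>\<mu>\<bar> + 1}"
      by (force simp: Spec_def dist_real_def)
    ultimately show False
      using finite_subset[OF _ finite_imageI[OF fin[where M = "\<bar>\<mu>\<bar> + 1"]]] by blast
  qed
  ultimately show ?thesis using eigenvalue_gap[OF assms(1) d sep] by blast
qed

end
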